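(* Let $X$ and $Y$ be infinite-dimensional Banach spaces, and let $i:X\to Y$ be an isometric embedding. Then, for every $p\in[1,\infty)$, $\overline{i}(\mathrm{FBL}^{(p)}[X])$ is not a regular sublattice of $I_{w^*}^{p}[Y]$.
   Context: All Banach spaces are real; embeddings are linear. Let $1/p+1/p'=1$. For $z_1,\dots,z_n$ in a Banach space, $\|(z_i)_{i=1}^n\|_{p,\mathrm{weak}}=\sup\{\|\sum_i\alpha_i z_i\| : \|(\alpha_i)_i\|_{\ell_{p'}}\le 1\}$. For a Banach space $X$, $H_{w^*}[X]$ is the vector lattice (pointwise operations and order) of positively homogeneous functions $f:X^*\to\mathbb R$ that are weak$^*$-continuous on bounded sets. For $f\in H_{w^*}[X]$, $\|f\|_p$ is the infimum of all $C\ge 0$ such that $(\sum_{i=1}^n|f(x_i^* )|^p)^{1/p}\le C\|(x_i^* )_{i=1}^n\|_{p,\mathrm{weak}}$ for all $n$ and all $x_1^*,\dots,x_n^*\in X^*$. $H_{w^*}^p[X]=\{f\in H_{w^*}[X]:\|f\|_p<\infty\}$, normed by $\|\cdot\|_p$. For $x\in X$, $\delta_x(x^* )=\langle x^*,x\rangle$. $\mathrm{FVL}[X]$ is the vector sublattice of $H_{w^*}[X]$ generated by $\{\delta_x:x\in X\}$; $\mathrm{FBL}^{(p)}[X]$ is the closure of $\mathrm{FVL}[X]$ in $H_{w^*}^p[X]$; $I_{w^*}^p[X]$ is the (order) ideal of $H_{w^*}[X]$ generated by $\mathrm{FBL}^{(p)}[X]$. For a bounded operator $i:X\to Y$, $\overline{i}:H_{w^*}^p[X]\to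 H_{w^*}^p[Y]$ is the lattice homomorphism $[\overline{i}f](y^* )=f(i^*y^* )$; it maps $\mathrm{FBL}^{(p)}[X]$ into $\mathrm{FBL}^{(p)}[Y]$, and is injective when $i$ is. For an injective lattice homomorphism $j:E\to F$ of vector lattices, $j(E)$ is a regular sublattice of $F$ if for every set $A\subset E$ having a supremum $a$ in $E$, $ja$ is the supremum of $j(A)$ in $F$. *)

theory Defs
  imports "HOL-Analysis.Analysis"
begin

text \<open>
  The dual of a real normed space \<open>'a\<close> is the type \<open>'a \<Rightarrow>\<^sub>L real\<close> with the operator norm.
  Its topology of pointwise convergence is the library's strong operator topology, which for
  scalar-valued operators is exactly the weak-* topology.
\<close>

abbreviation weak_star_topology :: "('a::real_normed_vector \<Rightarrow>\<^sub>L real) topology" where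
  "weak_star_topology \<equiv> strong_operator_topology"

definition conj_exponent :: "real \<Rightarrow> ereal" where
  "conj_exponent p = (if p = 1 then \<infinity> else ereal (p / (p - 1)))"

text \<open>The norm of \<open>\<ell>\<^sub>q\<close> on finite sequences \<open>\<alpha> 1, \<dots>, \<alpha> n\<close>;
  the inserted \<open>0\<close> only matters for \<open>n = 0\<close>.\<close>

definition lq_norm :: "ereal \<Rightarrow> nat \<Rightarrow> (nat \<Rightarrow> real) \<Rightarrow> real" where
  "lq_norm q n \<alpha> =
     (if q = \<infinity> then Max (insert 0 ((\<lambda>k. \<bar>\<alpha> k\<bar>) ` {1..n}))
      else (\<Sum>k = 1..n. \<bar>\<alpha> k\<bar> powr real_of_ereal q) powr (1 / real_of_ereal q))"

definition weak_p_norm :: "real \<Rightarrow> nat \<Rightarrow> (nat \<Rightarrow> 'a::real_normed_vector) \<Rightarrow> real" where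
  "weak_p_norm p n z =
     Sup {norm (\<Sum>k = 1..n. \<alpha> k *\<^sub>R z k) | \<alpha>. lq_norm (conj_exponent p) n \<alpha> \<le> 1}"

definition H_wstar :: "(('a::real_normed_vector \<Rightarrow>\<^sub>L real) \<Rightarrow> real) set" where
  "H_wstar = {f. (\<forall>c x. 0 \<le> c \<longrightarrow> f (c *\<^sub>R x) = c * f x) \<and>
     (\<forall>B. bounded B \<longrightarrow> continuous_map (subtopology weak_star_topology B) euclideanreal f)}"

text \<open>The norm \<open>\<parallel>f\<parallel>\<^sub>p\<close>, with value \<open>top\<close> (the infimum of the empty set)
  if there is no admissible constant.\<close>

definition fbl_norm :: "real \<Rightarrow> (('a::real_normed_vector \<Rightarrow>\<^sub>L real) \<Rightarrow> real) \<Rightarrow> ennreal" where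
  "fbl_norm p f = Inf {ennreal C | C. 0 \<le> C \<and>
     (\<forall>n x. (\<Sum>k = 1..n. \<bar>f (x k)\<bar> powr p) powr (1 / p) \<le> C * weak_p_norm p n x)}"

definition Hp_wstar :: "real \<Rightarrow> (('a::real_normed_vector \<Rightarrow>\<^sub>L real) \<Rightarrow> real) set" where
  "Hp_wstar p = {f \<in> H_wstar. fbl_norm p f < top}"

definition delta :: "'a::real_normed_vector \<Rightarrow> ('a \<Rightarrow>\<^sub>L real) \<Rightarrow> real" where
  "delta x = (\<lambda>y. blinfun_apply y x)"

definition fun_subspace :: "('b \<Rightarrow> real) set \<Rightarrow> bool" where
  "fun_subspace S \<longleftrightarrow> (\<lambda>_. 0) \<in> S \<and>
     (\<forall>f\<in>S. \<forall>g\<in>S. (\<lambda>t. f t + g t) \<in> S) \<and> (\<forall>c. \<forall>f\<in>S. (\<lambda>t. c * f t) \<in> S)"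

definition vector_sublattice :: "('b \<Rightarrow> real) set \<Rightarrow> ('b \<Rightarrow> real) set \<Rightarrow> bool" where
  "vector_sublattice H S \<longleftrightarrow> S \<subseteq> H \<and> fun_subspace S \<and>
     (\<forall>f\<in>S. \<forall>g\<in>S. (\<lambda>t. max (f t) (g t)) \<in> S \<and> (\<lambda>t. min (f t) (g t)) \<in> S)"

definition order_ideal :: "('b \<Rightarrow> real) set \<Rightarrow> ('b \<Rightarrow> real) set \<Rightarrow> bool" where
  "order_ideal H S \<longleftrightarrow> S \<subseteq> H \<and> fun_subspace S \<and>
     (\<forall>g\<in>S. \<forall>f\<in>H. (\<forall>t. \<bar>f t\<bar> \<le> \<bar>g t\<bar>) \<longrightarrow> f \<in> S)"

definition FVL :: "(('a::real_normed_vector \<Rightarrow>\<^sub>L real) \<Rightarrow> real) set" where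
  "FVL = vector_sublattice H_wstar hull range delta"

definition FBL :: "real \<Rightarrow> (('a::real_normed_vector \<Rightarrow>\<^sub>L real) \<Rightarrow> real) set" where
  "FBL p = {f \<in> Hp_wstar p. \<forall>e>0. \<exists>g\<in>FVL. fbl_norm p (\<lambda>t. f t - g t) < ennreal e}"

definition I_wstar :: "real \<Rightarrow> (('a::real_normed_vector \<Rightarrow>\<^sub>L real) \<Rightarrow> real) set" where
  "I_wstar p = order_ideal H_wstar hull FBL p"

text \<open>The adjoint of \<open>i\<close> maps \<open>y\<close> to \<open>y o\<^sub>L i\<close>.\<close>

definition induced_hom ::
  "('a::real_normed_vector \<Rightarrow>\<^sub>L 'b::real_normed_vector) \<Rightarrow>
   (('a \<Rightarrow>\<^sub>L real) \<Rightarrow> real) \<Rightarrow> (('b \<Rightarrow>\<^sub>L real) \<Rightarrow> real)" where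
  "induced_hom i f = (\<lambda>y. f (y o\<^sub>L i))"

definition is_supremum_in :: "'c::order set \<Rightarrow> 'c set \<Rightarrow> 'c \<Rightarrow> bool" where
  "is_supremum_in E A a \<longleftrightarrow>
     a \<in> E \<and> (\<forall>x\<in>A. x \<le> a) \<and> (\<forall>b\<in>E. (\<forall>x\<in>A. x \<le> b) \<longrightarrow> a \<le> b)"

text \<open>The image \<open>j ` E\<close> is a regular sublattice of \<open>F\<close>.  The notion presupposes that
  \<open>j\<close> restricts to an injective lattice homomorphism from \<open>E\<close> to \<open>F\<close>; this is a
  precondition rather than a conjunct, so the negation asserts that some existing supremum
  is not preserved.\<close>

definition regular_image :: "('c::order \<Rightarrow> 'd::order) \<Rightarrow> 'c set \<Rightarrow> 'd set \<Rightarrow> bool" where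
  "regular_image j E F \<longleftrightarrow>
     (\<forall>A a. A \<subseteq> E \<longrightarrow> is_supremum_in E A a \<longrightarrow> is_supremum_in F (j ` A) (j a))"

end

theory Submission
  imports Defs
begin

text \<open>
  Let \<open>g = max (\<bar>\<delta>\<^sub>e\<bar> - w) 0\<close>, where \<open>w\<close> is the seminorm \<open>\<Sum>j. a\<^sub>j max {\<bar>\<delta>\<^sub>v\<bar> | v \<in> V\<^sub>j}\<close> with finite sets \<open>V\<^sub>j\<close>
  in the unit ball of \<open>X\<close> and summable weights \<open>a\<^sub>j\<close>. Replacing \<open>w\<close> by its partial sums gives a
  sequence in \<open>FVL[X]\<close> decreasing uniformly on bounded sets to \<open>g\<close>, so \<open>g\<close> is weak-* continuous
  there and the pullback of \<open>g\<close> is a nonzero lower bound of the image of that sequence in the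
  ideal over \<open>Y\<close>. It remains to choose \<open>w\<close> such that the sequence has infimum \<open>0\<close> in \<open>FBL[X]\<close>.

  If \<open>b \<in> FBL[X]\<close> is negative at \<open>x\<close> and \<open>b \<ge> -g\<close>, approximate \<open>b\<close> by some \<open>h \<in> FVL[X]\<close>, which only
  depends on the values at finitely many vectors. Moving \<open>x\<close> by functionals \<open>u\<close> that annihilate
  these vectors and \<open>e\<close> leaves \<open>h\<close> unchanged, while \<open>b \<ge> 0\<close> as soon as \<open>w u\<close> is large. The
  \<open>p\<close>-norm of \<open>b - h\<close> cannot be small if the functionals \<open>u\<close> can be chosen with \<open>w u\<close> large but
  weakly \<open>p\<close>-summable with small constant. The existence of such families for a suitable \<open>w\<close>
  expresses that the identity of the infinite-dimensional space \<open>X\<^sup>*\<close> is not \<open>p\<close>-summing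
  (Dvoretzky--Rogers).
\<close>

subsection \<open>Separation of points by functionals\<close>

definition sublinear :: "('a::real_vector \<Rightarrow> real) \<Rightarrow> bool" where
  "sublinear q \<longleftrightarrow> (\<forall>x y. q (x + y) \<le> q x + q y) \<and> (\<forall>x t. 0 \<le> t \<longrightarrow> q (t *\<^sub>R x) = t * q x)"

lemma sublinear_add: "sublinear q \<Longrightarrow> q (x + y) \<le> q x + q y"
  by (simp add: sublinear_def)

lemma sublinear_scaleR: "sublinear q \<Longrightarrow> 0 \<le> t \<Longrightarrow> q (t *\<^sub>R x) = t * q x"
  by (simp add: sublinear_def)

lemma sublinear_zero: "sublinear q \<Longrightarrow> q 0 = 0"
  using sublinear_scaleR[of q 0 0] by simp

lemma sublinear_minus_ge: "sublinear q \<Longrightarrow> - q (- x) \<le> q x"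
  using sublinear_add[of q x "- x"] sublinear_zero[of q] by simp

lemma sublinearI:
  assumes add: "\<And>x y. q (x + y) \<le> q x + q y"
    and scale: "\<And>x t. 0 < t \<Longrightarrow> q (t *\<^sub>R x) \<le> t * q x" and zero: "q 0 = 0"
  shows "sublinear q"
  unfolding sublinear_def
proof (intro conjI allI impI add)
  fix x and t :: real
  assume "0 \<le> t"
  show "q (t *\<^sub>R x) = t * q x"
  proof (cases "t = 0")
    case False
    with \<open>0 \<le> t\<close> have "t > 0" by simp
    then have "q ((1 / t) *\<^sub>R t *\<^sub>R x) \<le> (1 / t) * q (t *\<^sub>R x)" by (intro scale) simp
    with \<open>t > 0\<close> have "t * q x \<le> q (t *\<^sub>R x)" by (simp add: field_simps)
    with scale[OF \<open>t > 0\<close>, of x] show ?thesis by simp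
  qed (simp add: zero)
qed

text \<open>The witness \<open>r x\<close> is the infimum of
  \<open>q (x + t *\<^sub>R z) - t * q z\<close> over \<open>0 \<le> t\<close>; \<open>t = 0\<close>
  gives \<open>r \<le> q\<close> and \<open>t = 1\<close> gives the bound at \<open>- z\<close>. It
  serves twice: to show that minimal functionals are odd, and to fix the sign of a functional at a
  given vector.\<close>

lemma sublinear_shift:
  fixes q :: "'a::real_vector \<Rightarrow> real"
  assumes q: "sublinear q"
  obtains r where "sublinear r" "\<And>x. r x \<le> q x" "r (- z) \<le> - q z"
proof
  define S where "S x = (\<lambda>t. q (x + t *\<^sub>R z) - t * q z) ` {0..}" for x
  define r where "r x = Inf (S x)" for x
  \<comment> \<open>Boundedness below makes the real infimum meaningful. It comes from writing
    \<open>t *\<^sub>R z\<close> as the sum of \<open>- x\<close> and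
    \<open>x + t *\<^sub>R z\<close>.\<close>
  have lb: "- q (- x) \<le> s" if "s \<in> S x" for x s
  proof -
    from that obtain t where t: "0 \<le> t" "s = q (x + t *\<^sub>R z) - t * q z" unfolding S_def by auto
    have "q (t *\<^sub>R z) \<le> q (- x) + q (x + t *\<^sub>R z)"
      using sublinear_add[OF q, of "- x" "x + t *\<^sub>R z"] by simp
    then show ?thesis using t sublinear_scaleR[OF q t(1), of z] by simp
  qed
  have bdd: "bdd_below (S x)" for x using lb by (rule bdd_belowI)
  have ne: "S x \<noteq> {}" for x by (simp add: S_def)
  have le: "r x \<le> q (x + t *\<^sub>R z) - t * q z" if "0 \<le> t" for x t
    unfolding r_def by (rule cInf_lower[OF _ bdd]) (use that in \<open>auto simp: S_def\<close>)
  show "r x \<le> q x" for x using le[of 0 x] by simp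
  show "r (- z) \<le> - q z" using le[of 1 "- z"] sublinear_zero[OF q] by simp
  have greatest: "c \<le> r x" if "\<And>t. 0 \<le> t \<Longrightarrow> c \<le> q (x + t *\<^sub>R z) - t * q z" for c x
    unfolding r_def by (rule cInf_greatest[OF ne]) (use that in \<open>auto simp: S_def\<close>)
  show "sublinear r"
  proof (rule sublinearI)
    fix x y
    \<comment> \<open>The two infima are taken one after the other: shifts by \<open>s\<close> at
      \<open>x\<close> and by \<open>t\<close> at \<open>y\<close> combine to the shift by
      \<open>s + t\<close> at \<open>x + y\<close>.\<close>
    have "r (x + y) - r y \<le> r x"
    proof (rule greatest)
      fix s :: real assume s: "0 \<le> s"
      have "r (x + y) - (q (x + s *\<^sub>R z) - s * q z) \<le> r y"
      proof (rule greatest)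
        fix t :: real assume t: "0 \<le> t"
        have "r (x + y) \<le> q ((x + s *\<^sub>R z) + (y + t *\<^sub>R z)) - (s + t) * q z"
          using le[of "s + t" "x + y"] s t by (simp add: algebra_simps)
        also have "\<dots> \<le> q (x + s *\<^sub>R z) + q (y + t *\<^sub>R z) - (s + t) * q z"
          using sublinear_add[OF q] by simp
        finally show "r (x + y) - (q (x + s *\<^sub>R z) - s * q z) \<le> q (y + t *\<^sub>R z) - t * q z"
          by (simp add: algebra_simps)
      qed
      then show "r (x + y) - r y \<le> q (x + s *\<^sub>R z) - s * q z" by simp
    qed
    then show "r (x + y) \<le> r x + r y" by simp
  next
    fix x and t :: real assume t: "0 < t"
    have "r (t *\<^sub>R x) / t \<le> r x"
    proof (rule greatest)
      fix s :: real assume s: "0 \<le> s"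
      have "r (t *\<^sub>R x) \<le> q (t *\<^sub>R (x + s *\<^sub>R z)) - (t * s) * q z"
        using le[of "t * s" "t *\<^sub>R x"] s t by (simp add: algebra_simps)
      also have "\<dots> = t * (q (x + s *\<^sub>R z) - s * q z)"
        using t sublinear_scaleR[OF q, of t "x + s *\<^sub>R z"] by (simp add: right_diff_distrib)
      finally show "r (t *\<^sub>R x) / t \<le> q (x + s *\<^sub>R z) - s * q z"
        using t by (simp add: field_simps)
    qed
    then show "r (t *\<^sub>R x) \<le> t * r x" using t by (simp add: field_simps)
  next
    show "r 0 = 0"
    proof (rule antisym)
      show "r 0 \<le> 0" using le[of 0 0] sublinear_zero[OF q] by simp
      show "0 \<le> r 0" by (rule greatest) (simp add: sublinear_scaleR[OF q])
    qed
  qed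
qed

text \<open>Minimal sublinear functionals are linear, so Zorn's lemma replaces the extension argument
  in the Hahn--Banach theorem.\<close>

lemma minimal_sublinear_below:
  fixes q :: "'a::real_vector \<Rightarrow> real"
  assumes q: "sublinear q"
  obtains m where "sublinear m" "m \<le> q" "\<And>r. sublinear r \<Longrightarrow> r \<le> m \<Longrightarrow> r = m"
proof -
  let ?A = "{r. sublinear r \<and> r \<le> q}"
  have "\<exists>m\<in>?A. \<forall>r\<in>?A. r \<le> m \<longrightarrow> r = m"
  proof (rule predicate_Zorn)
    \<comment> \<open>The reversed order turns the maximal element of Zorn's lemma into a minimal
      one.\<close>
    show "partial_order_on ?A (relation_of (\<lambda>a b. b \<le> a) ?A)"
      by (rule partial_order_on_relation_ofI) auto
    fix C assume C: "C \<in> Chains (relation_of (\<lambda>a b. b \<le> a) ?A)"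
    then have CA: "r \<in> ?A" if "r \<in> C" for r
      using that unfolding Chains_def relation_of_def by fastforce
    have tot: "r \<le> s \<or> s \<le> r" if "r \<in> C" "s \<in> C" for r s
      using C that unfolding Chains_def relation_of_def by fastforce
    show "\<exists>u\<in>?A. \<forall>a\<in>C. u \<le> a"
    proof (cases "C = {}")
      case True
      then show ?thesis using q by auto
    next
      case ne: False
      define u where "u x = (INF r\<in>C. r x)" for x
      have bdd: "bdd_below ((\<lambda>r. r x) ` C)" for x
      proof (rule bdd_belowI2)
        fix r assume "r \<in> C"
        from CA[OF this] have "sublinear r" "r (- x) \<le> q (- x)" by (auto simp: le_fun_def)
        then show "- q (- x) \<le> r x" using sublinear_minus_ge[of r x] by simp
      qed
      have le: "u x \<le> r x" if "r \<in> C" for r x unfolding u_def by (rule cINF_lower[OF bdd that])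
      have greatest: "c \<le> u x" if "\<And>r. r \<in> C \<Longrightarrow> c \<le> r x" for c x
        unfolding u_def by (rule cINF_greatest[OF ne that])
      have "sublinear u"
      proof (rule sublinearI)
        fix x y
        have "u (x + y) - u y \<le> u x"
        proof (rule greatest)
          fix r assume r: "r \<in> C"
          have "u (x + y) - r x \<le> u y"
          proof (rule greatest)
            fix s assume s: "s \<in> C"
            \<comment> \<open>An infimum of sublinear functionals is not subadditive in general. In
              a chain, \<open>r\<close> and \<open>s\<close> may both be replaced by the smaller of
              the two.\<close>
            define k where "k = (if r \<le> s then r else s)"
            have k: "k \<in> C" "k x \<le> r x" "k y \<le> s y"
              using r s tot[OF r s] by (auto simp: k_def le_fun_def)
            then show "u (x + y) - r x \<le> s y"
              using le[OF k(1), of "x + y"] CA[OF k(1)] sublinear_add[of k x y] by auto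
          qed
          then show "u (x + y) - u y \<le> r x" by simp
        qed
        then show "u (x + y) \<le> u x + u y" by simp
      next
        fix x and t :: real assume t: "0 < t"
        have "u (t *\<^sub>R x) / t \<le> u x"
        proof (rule greatest)
          fix r assume r: "r \<in> C"
          then show "u (t *\<^sub>R x) / t \<le> r x"
            using le[OF r, of "t *\<^sub>R x"] CA[OF r] t sublinear_scaleR[of r t x]
            by (simp add: field_simps)
        qed
        then show "u (t *\<^sub>R x) \<le> t * u x" using t by (simp add: field_simps)
      next
        have "r 0 = 0" if "r \<in> C" for r using CA[OF that] sublinear_zero by auto
        then have "(\<lambda>r. r 0) ` C = {0}" using ne by force
        then show "u 0 = 0" by (simp add: u_def)
      qed
      moreover have "u \<le> q"
        using ne le CA by (metis (no_types, lifting) ex_in_conv le_fun_def mem_Collect_eq order_trans)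
      ultimately show ?thesis using le by (auto simp: le_fun_def)
    qed
  qed
  then show ?thesis using that by (smt (verit) mem_Collect_eq order_trans)
qed

text \<open>By minimality \<open>m\<close> coincides with its own shift in every direction
  \<open>z\<close>, hence \<open>m (- z) \<le> - m z\<close>. So \<open>m\<close> is odd, and odd
  sublinear functionals are linear.\<close>

lemma minimal_sublinear_linear:
  fixes m :: "'a::real_vector \<Rightarrow> real"
  assumes m: "sublinear m" and min: "\<And>r. sublinear r \<Longrightarrow> r \<le> m \<Longrightarrow> r = m"
  shows "linear m"
proof -
  have odd: "m (- z) = - m z" for z
  proof (rule antisym)
    obtain r where "sublinear r" "\<And>x. r x \<le> m x" "r (- z) \<le> - m z"
      using sublinear_shift[OF m, of z] by blast
    with min[of r] show "m (- z) \<le> - m z" by (auto simp: le_fun_def)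
    show "- m z \<le> m (- z)" using sublinear_minus_ge[OF m, of "- z"] by simp
  qed
  show ?thesis
  proof (rule linearI)
    fix x y
    have "m x \<le> m (x + y) - m y" using sublinear_add[OF m, of "x + y" "- y"] odd by simp
    with sublinear_add[OF m, of x y] show "m (x + y) = m x + m y" by simp
  next
    fix t x
    show "m (t *\<^sub>R x) = t *\<^sub>R m x"
    proof (cases "0 \<le> t")
      case False
      then have "m (- t *\<^sub>R x) = - t * m x" by (intro sublinear_scaleR[OF m]) simp
      then show ?thesis using odd[of "t *\<^sub>R x"] by simp
    qed (simp add: sublinear_scaleR[OF m])
  qed
qed

section \<open>Hahn--Banach functionals and biorthogonal systems\<close>

lemma ex_functional_neq_zero:
  fixes z :: "'a::real_normed_vector"
  assumes "z \<noteq> 0"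
  obtains f :: "'a \<Rightarrow>\<^sub>L real" where "blinfun_apply f z \<noteq> 0"
proof -
  have "sublinear (norm :: 'a \<Rightarrow> real)" by (simp add: sublinear_def norm_triangle_ineq)
  \<comment> \<open>Shifting the norm before minimising forces
    \<open>m (- z) \<le> - norm z\<close>, so the linear \<open>m\<close> cannot vanish at
    \<open>z\<close>; domination by the norm makes it bounded.\<close>
  then obtain q :: "'a \<Rightarrow> real" where q: "sublinear q" "\<And>x. q x \<le> norm x" "q (- z) \<le> - norm z"
    using sublinear_shift[of norm z] by blast
  obtain m where m: "sublinear m" "m \<le> q" "\<And>r. sublinear r \<Longrightarrow> r \<le> m \<Longrightarrow> r = m"
    using minimal_sublinear_below[OF q(1)] by blast
  have lin: "linear m" by (rule minimal_sublinear_linear[OF m(1,3)])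
  have le: "m x \<le> norm x" for x using m(2) q(2) by (meson le_funD order_trans)
  have "norm (m x) \<le> norm x * 1" for x
    using le[of x] le[of "- x"] linear_neg[OF lin, of x] by auto
  with lin have "bounded_linear m" by (intro bounded_linear_intro[of m 1]) (auto simp: linear_add linear_scale)
  then have "blinfun_apply (Blinfun m) z = m z" by (simp add: bounded_linear_Blinfun_apply)
  moreover have "m (- z) < 0" using m(2) q(3) assms by (smt (verit) le_funD zero_less_norm_iff)
  then have "m z \<noteq> 0" using linear_neg[OF lin, of z] by auto
  ultimately show ?thesis using that[of "Blinfun m"] by simp
qed

text \<open>Infinite dimension always leaves a vector outside the span of those already chosen.
  Subtracting its components makes it invisible to the old functionals without making it
  zero.\<close>

lemma ex_biorthogonal_system:
  assumes "\<nexists>B :: 'a::real_normed_vector set. finite B \<and> span B = UNIV"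
  shows "\<exists>(x :: nat \<Rightarrow> 'a) (u :: nat \<Rightarrow> 'a \<Rightarrow>\<^sub>L real).
    \<forall>i<n. \<forall>j<n. blinfun_apply (u i) (x j) = (if i = j then 1 else 0)"
proof (induction n)
  case (Suc n)
  then obtain x :: "nat \<Rightarrow> 'a" and u :: "nat \<Rightarrow> 'a \<Rightarrow>\<^sub>L real"
    where xu: "\<And>i j. i < n \<Longrightarrow> j < n \<Longrightarrow> blinfun_apply (u i) (x j) = (if i = j then 1 else 0)"
    by metis
  obtain y where y: "y \<notin> span (x ` {..<n})" using assms by blast
  define z where "z = y - (\<Sum>j<n. blinfun_apply (u j) y *\<^sub>R x j)"
  have "(\<Sum>j<n. blinfun_apply (u j) y *\<^sub>R x j) \<in> span (x ` {..<n})"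
    by (intro span_sum span_scale span_base) auto
  with y have "z \<noteq> 0" unfolding z_def by auto
  have uz: "blinfun_apply (u i) z = 0" if "i < n" for i
    using that by (simp add: z_def blinfun.diff_right blinfun.sum_right blinfun.scaleR_right xu
        if_distrib[of "\<lambda>t. _ * t"] cong: if_cong)
  obtain f :: "'a \<Rightarrow>\<^sub>L real" where f: "blinfun_apply f z \<noteq> 0"
    using ex_functional_neq_zero[OF \<open>z \<noteq> 0\<close>] .
  \<comment> \<open>The subtracted sum makes \<open>v\<close> vanish at the old vectors. It does not
    change the value at \<open>z\<close>, where the old functionals are zero, so the factor
    normalises that value to 1.\<close>
  define v where
    "v = (1 / blinfun_apply f z) *\<^sub>R (f - (\<Sum>j<n. blinfun_apply f (x j) *\<^sub>R u j))"
  have v: "blinfun_apply v (x i) = 0" if "i < n" for i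
    using that by (simp add: v_def blinfun.diff_left blinfun.sum_left blinfun.scaleR_left xu
        if_distrib[of "\<lambda>t. _ * t"] cong: if_cong)
  have vz: "blinfun_apply v z = 1"
    using f by (simp add: v_def blinfun.diff_left blinfun.sum_left blinfun.scaleR_left uz)
  show ?case
    by (rule exI[of _ "x(n := z)"], rule exI[of _ "u(n := v)"])
      (use xu uz v vz in \<open>auto simp: less_Suc_eq\<close>)
qed simp

subsection \<open>The Dvoretzky--Rogers theorem\<close>

text \<open>A minimax principle proved by descent: using the shortfalls below \<open>c\<close> as
  weights gives a point of \<open>B\<close>, and moving a little mass to that point would push the
  squared shortfall below its infimum. The gap between \<open>d\<close> and \<open>c\<close> makes
  up for a minimum that need not be attained.\<close>

lemma finite_minimax:
  fixes y :: "'x \<Rightarrow> 'u \<Rightarrow> real"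
  assumes U: "finite U" and B: "B \<noteq> {}"
    and y: "\<And>x u. x \<in> B \<Longrightarrow> u \<in> U \<Longrightarrow> 0 \<le> y x u \<and> y x u \<le> 1"
    and weights: "\<And>l. (\<And>u. u \<in> U \<Longrightarrow> 0 \<le> l u) \<Longrightarrow> 0 < sum l U \<Longrightarrow>
      \<exists>x\<in>B. c * sum l U \<le> (\<Sum>u\<in>U. l u * y x u)"
    and dc: "d < c"
  obtains T \<nu> where "finite T" "T \<subseteq> B" "\<And>x. x \<in> T \<Longrightarrow> 0 \<le> \<nu> x" "sum \<nu> T = 1"
    "\<And>u. u \<in> U \<Longrightarrow> d \<le> (\<Sum>x\<in>T. \<nu> x * y x u)"
proof -
  define P where "P T \<nu> \<longleftrightarrow> finite T \<and> T \<subseteq> B \<and> (\<forall>x\<in>T. 0 \<le> \<nu> x) \<and> sum \<nu> T = 1"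
    for T and \<nu> :: "'x \<Rightarrow> real"
  define z where "z T \<nu> u = (\<Sum>x\<in>T. \<nu> x * y x u)" for T \<nu> u
  \<comment> \<open>If the shortfall \<open>\<phi>\<close> stays away from \<open>0\<close>, a near-minimiser yields violating weights \<open>l\<close>.\<close>
  define \<phi> where "\<phi> w = (\<Sum>u\<in>U. (max 0 (c - w u))\<^sup>2)" for w :: "'u \<Rightarrow> real"
  \<comment> \<open>With a total below this threshold, each single shortfall is less than
    \<open>c - d\<close>.\<close>
  have "\<exists>T \<nu>. P T \<nu> \<and> \<phi> (z T \<nu>) < (c - d)\<^sup>2"
  proof (rule ccontr)
    assume "\<not> ?thesis"
    then have big: "(c - d)\<^sup>2 \<le> \<phi> (z T \<nu>)" if "P T \<nu>" for T \<nu>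
      using that by (meson not_less)
    define H where "H = {\<phi> (z T \<nu>) | T \<nu>. P T \<nu>}"
    define D where "D = Inf H"
    obtain x0 where "x0 \<in> B" using B by blast
    then have "P {x0} (\<lambda>_. 1)" by (simp add: P_def)
    then have "H \<noteq> {}" unfolding H_def by blast
    have lb: "(c - d)\<^sup>2 \<le> h" if "h \<in> H" for h using that big unfolding H_def by blast
    have "(c - d)\<^sup>2 \<le> D" unfolding D_def by (rule cInf_greatest[OF \<open>H \<noteq> {}\<close> lb])
    moreover have "0 < (c - d)\<^sup>2" using dc by simp
    ultimately have D: "0 < D" by linarith
    have bdd: "bdd_below H" using lb by (rule bdd_belowI)
    have D_le: "D \<le> \<phi> (z T \<nu>)" if "P T \<nu>" for T \<nu>
      unfolding D_def by (rule cInf_lower[OF _ bdd]) (use that in \<open>auto simp: H_def\<close>)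
    define m where "m = 1 + real (card U)"
    have m: "0 < m" by (simp add: m_def)
    \<comment> \<open>The first-order gain of a step of length \<open>t\<close> is at least
      \<open>2 * t * D\<close>, while the quadratic error and the slack \<open>t\<^sup>2\<close> of
      the near-minimiser cost at most \<open>t\<^sup>2 * m\<close>. The summand 1 in
      \<open>m\<close> accounts for the slack; \<open>t * m \<le> D\<close> makes the gain
      win.\<close>
    define t where "t = min 1 (D / m)"
    have t: "0 < t" "t \<le> 1" "t * m \<le> D"
      using D m by (auto simp: t_def min_def field_simps)
    have "\<exists>h\<in>H. h < D + t\<^sup>2"
      using cInf_lessD[OF \<open>H \<noteq> {}\<close>, of "D + t\<^sup>2"] t by (auto simp: D_def)
    then obtain T \<nu> where T: "P T \<nu>" and near: "\<phi> (z T \<nu>) < D + t\<^sup>2"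
      unfolding H_def by blast
    define l where "l u = max 0 (c - z T \<nu> u)" for u
    have z01: "0 \<le> z T \<nu> u \<and> z T \<nu> u \<le> 1" if u: "u \<in> U" for u
    proof -
      have "0 \<le> z T \<nu> u" unfolding z_def using T y u by (intro sum_nonneg) (auto simp: P_def)
      moreover have "z T \<nu> u \<le> (\<Sum>x\<in>T. \<nu> x * 1)"
        unfolding z_def using T y u by (intro sum_mono mult_left_mono) (auto simp: P_def)
      ultimately show ?thesis using T by (simp add: P_def)
    qed
    have \<phi>_l: "\<phi> (z T \<nu>) = (\<Sum>u\<in>U. (l u)\<^sup>2)" by (simp add: \<phi>_def l_def)
    have l0: "0 \<le> l u" for u by (simp add: l_def)
    have "0 < sum l U"
    proof (rule ccontr)
      assume "\<not> 0 < sum l U"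
      then have "sum l U = 0" using l0 by (meson antisym not_less sum_nonneg)
      then have "\<forall>u\<in>U. l u = 0" using U l0 by (simp add: sum_nonneg_eq_0_iff)
      then show False using \<phi>_l D D_le[OF T] by simp
    qed
    with weights[of l] l0 obtain x
      where x: "x \<in> B" "c * sum l U \<le> (\<Sum>u\<in>U. l u * y x u)" by blast
    \<comment> \<open>The new measure moves the fraction \<open>t\<close> of the mass to
      \<open>x\<close>. The case distinctions also cover an \<open>x\<close> that already belongs to
      \<open>T\<close>.\<close>
    define \<nu>' where "\<nu>' w = (1 - t) * (if w \<in> T then \<nu> w else 0) + t * (if w = x then 1 else 0)" for w
    have fin: "finite T" using T by (simp add: P_def)
    have sumT: "(\<Sum>w\<in>insert x T. (if w \<in> T then \<nu> w else 0) * g w) = (\<Sum>w\<in>T. \<nu> w * g w)"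
      for g :: "'x \<Rightarrow> real"
      using fin by (intro sum.mono_neutral_cong_right) auto
    have sum_\<nu>': "(\<Sum>w\<in>insert x T. \<nu>' w * g w) = (1 - t) * (\<Sum>w\<in>T. \<nu> w * g w) + t * g x"
      for g :: "'x \<Rightarrow> real"
    proof -
      have "(\<Sum>w\<in>insert x T. \<nu>' w * g w) =
        (1 - t) * (\<Sum>w\<in>insert x T. (if w \<in> T then \<nu> w else 0) * g w)
         + t * (\<Sum>w\<in>insert x T. (if w = x then 1 else 0) * g w)"
        by (simp add: \<nu>'_def sum_distrib_left sum.distrib[symmetric] algebra_simps)
      also have "(\<Sum>w\<in>insert x T. (if w = x then 1 else 0) * g w) = g x"
        using fin by (simp add: if_distrib[of "\<lambda>s. s * _"] cong: if_cong)
      finally show ?thesis by (simp add: sumT)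
    qed
    have P': "P (insert x T) \<nu>'"
      unfolding P_def
    proof (intro conjI ballI)
      show "sum \<nu>' (insert x T) = 1" using sum_\<nu>'[of "\<lambda>_. 1"] T by (simp add: P_def)
      show "0 \<le> \<nu>' w" if "w \<in> insert x T" for w
        using T t by (auto simp: \<nu>'_def P_def)
    qed (use T x fin in \<open>auto simp: P_def\<close>)
    define \<delta> where "\<delta> u = y x u - z T \<nu> u" for u
    have z': "z (insert x T) \<nu>' u = z T \<nu> u + t * \<delta> u" for u
      using sum_\<nu>'[of "\<lambda>w. y w u"] unfolding z_def \<delta>_def by (simp add: algebra_simps)
    have "\<phi> (z (insert x T) \<nu>') \<le> (\<Sum>u\<in>U. (l u - t * \<delta> u)\<^sup>2)"
      unfolding \<phi>_def
    proof (rule sum_mono)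
      fix u
      have "\<bar>max 0 (c - z (insert x T) \<nu>' u)\<bar> \<le> \<bar>l u - t * \<delta> u\<bar>"
        unfolding z' l_def by (auto simp: max_def)
      then show "(max 0 (c - z (insert x T) \<nu>' u))\<^sup>2 \<le> (l u - t * \<delta> u)\<^sup>2"
        using abs_le_square_iff by blast
    qed
    also have "\<dots> = \<phi> (z T \<nu>) - 2 * t * (\<Sum>u\<in>U. l u * \<delta> u) + t\<^sup>2 * (\<Sum>u\<in>U. (\<delta> u)\<^sup>2)"
      unfolding \<phi>_l
      by (simp add: power2_eq_square algebra_simps sum.distrib sum_subtractf sum_distrib_left)
    finally have step: "D \<le> \<phi> (z T \<nu>) - 2 * t * (\<Sum>u\<in>U. l u * \<delta> u) + t\<^sup>2 * (\<Sum>u\<in>U. (\<delta> u)\<^sup>2)"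
      using D_le[OF P'] by linarith
    have "(\<delta> u)\<^sup>2 \<le> 1" if "u \<in> U" for u
      using z01[OF that] y[OF x(1) that] by (simp add: \<delta>_def abs_square_le_1 abs_le_iff)
    then have "(\<Sum>u\<in>U. (\<delta> u)\<^sup>2) \<le> real (card U)" using sum_mono[of U "\<lambda>u. (\<delta> u)\<^sup>2" "\<lambda>_. 1"] by simp
    then have t2: "t\<^sup>2 * (\<Sum>u\<in>U. (\<delta> u)\<^sup>2) \<le> t\<^sup>2 * real (card U)" by (simp add: mult_left_mono)
    \<comment> \<open>Since \<open>l u\<close> vanishes where \<open>c - z T \<nu> u\<close> is
      negative, one factor of the square can be unclipped; then the choice of \<open>x\<close> for
      the weights \<open>l\<close> applies.\<close>
    have "D \<le> (\<Sum>u\<in>U. (l u)\<^sup>2)" using D_le[OF T] \<phi>_l by simp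
    also have "\<dots> = (\<Sum>u\<in>U. l u * (c - z T \<nu> u))"
      by (rule sum.cong) (auto simp: l_def max_def power2_eq_square)
    also have "\<dots> \<le> (\<Sum>u\<in>U. l u * \<delta> u)"
      using x(2) by (simp add: \<delta>_def right_diff_distrib sum_subtractf sum_distrib_left mult.commute)
    finally have "2 * t * D \<le> 2 * t * (\<Sum>u\<in>U. l u * \<delta> u)" using t by simp
    with step near t2 have "2 * t * D < t\<^sup>2 * m" by (simp add: m_def algebra_simps)
    then have "2 * D < t * m" using t by (simp add: power2_eq_square)
    with t D show False by linarith
  qed
  then obtain T \<nu> where T: "P T \<nu>" and small: "\<phi> (z T \<nu>) < (c - d)\<^sup>2" by blast
  have "d \<le> z T \<nu> u" if "u \<in> U" for u
  proof -
    have "(max 0 (c - z T \<nu> u))\<^sup>2 \<le> \<phi> (z T \<nu>)"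
      unfolding \<phi>_def by (rule member_le_sum[OF that _ U]) simp
    with small have "(max 0 (c - z T \<nu> u))\<^sup>2 < (c - d)\<^sup>2" by linarith
    then have "max 0 (c - z T \<nu> u) < c - d" by (rule power2_less_imp_less) (use dc in simp)
    then show ?thesis by simp
  qed
  with T show ?thesis by (intro that[of T \<nu>]) (auto simp: P_def z_def)
qed

text \<open>Stated for a symmetric bilinear form that is definite only on the span at hand: the form
  used later comes from a finitely supported measure and may degenerate on the whole dual.\<close>

lemma gram_schmidt:
  fixes b :: "'v::real_vector \<Rightarrow> 'v \<Rightarrow> real" and u :: "nat \<Rightarrow> 'v"
  assumes lin: "\<And>v. linear (b v)" and sym: "\<And>v w. b v w = b w v"
    and pos: "\<And>v. v \<in> span (u ` {..<n}) \<Longrightarrow> v \<noteq> 0 \<Longrightarrow> 0 < b v v"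
    and indep: "\<And>k. k < n \<Longrightarrow> u k \<notin> span (u ` {..<k})"
  shows "\<exists>e. (\<forall>k<n. e k \<in> span (u ` {..<n})) \<and>
    (\<forall>j<n. \<forall>k<n. b (e j) (e k) = (if j = k then 1 else 0))"
  using pos indep
proof (induction n)
  case (Suc n)
  have sub: "span (u ` {..<n}) \<subseteq> span (u ` {..<Suc n})" by (intro span_mono) auto
  obtain e where e: "\<And>k. k < n \<Longrightarrow> e k \<in> span (u ` {..<n})"
    and on: "\<And>j k. j < n \<Longrightarrow> k < n \<Longrightarrow> b (e j) (e k) = (if j = k then 1 else 0)"
  proof -
    have "\<exists>e. (\<forall>k<n. e k \<in> span (u ` {..<n})) \<and>
      (\<forall>j<n. \<forall>k<n. b (e j) (e k) = (if j = k then 1 else 0))"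
      by (rule Suc.IH) (use Suc.prems sub in auto)
    then show ?thesis using that by blast
  qed
  define s where "s = (\<Sum>k<n. b (u n) (e k) *\<^sub>R e k)"
  define r where "r = u n - s"
  have s: "s \<in> span (u ` {..<n})" unfolding s_def by (intro span_sum span_scale e) auto
  have "r \<noteq> 0" using Suc.prems(2)[of n] s by (auto simp: r_def)
  moreover have r: "r \<in> span (u ` {..<Suc n})"
    unfolding r_def using s sub by (intro span_diff) (auto intro: span_base)
  ultimately have rr: "0 < b r r" using Suc.prems(1) by blast
  have re: "b (e j) r = 0" if "j < n" for j
    using that on
    by (simp add: r_def s_def linear_diff[OF lin] linear_sum[OF lin] linear_scale[OF lin] sym[of "e j" "u n"]
        if_distrib[of "\<lambda>t. _ * t"] cong: if_cong)
  define q where "q = r /\<^sub>R sqrt (b r r)"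
  have eq: "b (e j) q = 0" if "j < n" for j
    using re[OF that] by (simp add: q_def linear_scale[OF lin])
  have qe: "b q (e j) = 0" if "j < n" for j using eq[OF that] sym by simp
  have "b q q = (1 / sqrt (b r r)) * b q r" by (simp add: q_def linear_scale[OF lin] divide_inverse_commute)
  also have "b q r = (1 / sqrt (b r r)) * b r r"
    using sym[of q r] by (simp add: q_def linear_scale[OF lin] divide_inverse_commute)
  finally have qq: "b q q = 1" using rr by (simp add: field_simps)
  have q: "q \<in> span (u ` {..<Suc n})" unfolding q_def by (rule span_scale[OF r])
  show ?case
    by (rule exI[of _ "e(n := q)"])
      (use q qq qe eq on e sub in \<open>auto simp: less_Suc_eq\<close>)
qed simp


text \<open>The set is a Minkowski sum of segments, which are added one at a time. It supplies
  compactness of the unit sphere in a finite-dimensional subspace of the dual.\<close>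

lemma compact_box_sums:
  fixes u :: "nat \<Rightarrow> 'v::real_normed_vector"
  shows "compact {\<Sum>k<n. a k *\<^sub>R u k | a. \<forall>k<n. \<bar>a k\<bar> \<le> r k}"
proof (induction n)
  case (Suc n)
  let ?S = "\<lambda>n. {\<Sum>k<n. a k *\<^sub>R u k | a. \<forall>k<n. \<bar>a k\<bar> \<le> r k}"
  let ?T = "(\<lambda>t. t *\<^sub>R u n) ` {- r n..r n}"
  have "compact ?T"
    by (intro compact_continuous_image continuous_intros compact_Icc)
  with Suc have "compact {x + y | x y. x \<in> ?S n \<and> y \<in> ?T}" by (rule compact_sums)
  moreover have "?S (Suc n) = {x + y | x y. x \<in> ?S n \<and> y \<in> ?T}"
  proof (intro set_eqI iffI)
    fix v assume "v \<in> ?S (Suc n)"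
    then show "v \<in> {x + y | x y. x \<in> ?S n \<and> y \<in> ?T}"
      by (fastforce simp: abs_le_iff)
  next
    fix v assume "v \<in> {x + y | x y. x \<in> ?S n \<and> y \<in> ?T}"
    then obtain a t where v: "v = (\<Sum>k<n. a k *\<^sub>R u k) + t *\<^sub>R u n"
      and "\<forall>k<n. \<bar>a k\<bar> \<le> r k" "\<bar>t\<bar> \<le> r n" by (auto simp: abs_le_iff)
    then show "v \<in> ?S (Suc n)"
      by (intro CollectI exI[of _ "a(n := t)"]) (auto simp: less_Suc_eq intro!: sum.cong)
  qed
  ultimately show ?case by simp
qed simp

text \<open>A form of the Dvoretzky--Rogers theorem. If it failed, minimax would provide a probability
  measure \<open>\<nu>\<close> on the unit ball whose \<open>L\<^sub>2\<close> norm is equivalent to the operator norm on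
  subspaces of the dual of every finite dimension \<open>n\<close>, with constants independent of \<open>n\<close>.
  For an orthonormal basis \<open>e\<close> of such a subspace this bounds \<open>\<Sum>k<n. (e k x)\<^sup>2\<close> pointwise,
  and integrating against \<open>\<nu>\<close> bounds \<open>n\<close>.\<close>

lemma dvoretzky_rogers:
  assumes inf: "\<nexists>B :: 'a::real_normed_vector set. finite B \<and> span B = UNIV" and c: "0 < c"
  obtains U :: "('a::real_normed_vector \<Rightarrow>\<^sub>L real) set" and l where "finite U" "U \<subseteq> sphere 0 1"
    "\<And>u. u \<in> U \<Longrightarrow> 0 \<le> l u" "0 < sum l U"
    "\<And>x. norm x \<le> 1 \<Longrightarrow> (\<Sum>u\<in>U. l u * (blinfun_apply u x)\<^sup>2) \<le> c * sum l U"
proof (rule ccontr)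
  assume notthesis: "\<not> thesis"
  note result = that
  \<comment> \<open>The trace estimate at the end yields \<open>n \<le> 2 / c\<close>.\<close>
  obtain n :: nat where n: "2 / c < real n" using reals_Archimedean2 by blast
  then have "0 < real n" using c by (smt (verit) divide_pos_pos)
  then have "0 < n" by simp
  obtain x :: "nat \<Rightarrow> 'a" and u :: "nat \<Rightarrow> 'a \<Rightarrow>\<^sub>L real"
    where xu: "\<And>i j. i < n \<Longrightarrow> j < n \<Longrightarrow> blinfun_apply (u i) (x j) = (if i = j then 1 else 0)"
    using ex_biorthogonal_system[OF inf, of n] by metis
  define E where "E = span (u ` {..<n})"
  have E_repr: "v = (\<Sum>k<n. blinfun_apply v (x k) *\<^sub>R u k)" if "v \<in> E" for v
    using that unfolding E_def
  proof (induction rule: span_induct_alt)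
    case (step t w v)
    then obtain j where j: "j < n" "w = u j" by auto
    have "(\<Sum>k<n. blinfun_apply (t *\<^sub>R w + v) (x k) *\<^sub>R u k) =
      (\<Sum>k<n. if k = j then t *\<^sub>R u j else 0) + (\<Sum>k<n. blinfun_apply v (x k) *\<^sub>R u k)"
      unfolding sum.distrib[symmetric]
      by (rule sum.cong) (use j xu in \<open>auto simp: blinfun.add_left blinfun.scaleR_left algebra_simps\<close>)
    then show ?case using j step by simp
  qed simp
  \<comment> \<open>The coefficients of a unit vector \<open>v\<close> of \<open>E\<close> are its
    values at \<open>x k\<close>, so the box contains the whole unit sphere of
    \<open>E\<close>.\<close>
  define S where "S = {\<Sum>k<n. a k *\<^sub>R u k | a. \<forall>k<n. \<bar>a k\<bar> \<le> norm (x k)} \<inter> sphere 0 1"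
  have "closed {v :: 'a \<Rightarrow>\<^sub>L real. norm v = 1}"
    by (intro closed_Collect_eq continuous_intros)
  then have "closed (sphere (0 :: 'a \<Rightarrow>\<^sub>L real) 1)" by (simp add: sphere_def)
  then have "compact S" unfolding S_def by (intro compact_Int_closed compact_box_sums)
  \<comment> \<open>On the unit ball, passing from a unit vector to a net point changes squared
    values by at most \<open>2 * (c / 8)\<close>. This lowers the minimax level
    \<open>3 * c / 4\<close> to the level \<open>c / 2\<close> on all of the sphere.\<close>
  then obtain U where U: "finite U" "U \<subseteq> S" "S \<subseteq> (\<Union>v\<in>U. ball v (c / 8))"
  proof -
    have "0 < c / 8" using c by simp
    with \<open>compact S\<close> have "\<exists>K. finite K \<and> K \<subseteq> S \<and> S \<subseteq> (\<Union>v\<in>K. ball v (c / 8))"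
      by (intro seq_compact_imp_totally_bounded[rule_format] compact_imp_seq_compact)
    then show ?thesis using that by metis
  qed
  have ball: "\<bar>blinfun_apply v y\<bar> \<le> norm v" if "norm y \<le> 1" for v :: "'a \<Rightarrow>\<^sub>L real" and y
    using norm_blinfun[of v y] mult_left_mono[OF that, of "norm v"] by simp
  obtain T \<nu> where T: "finite T" "T \<subseteq> cball (0::'a) 1" "\<And>y. y \<in> T \<Longrightarrow> 0 \<le> \<nu> y" "sum \<nu> T = 1"
    and dom: "\<And>v. v \<in> U \<Longrightarrow> 3 * c / 4 \<le> (\<Sum>y\<in>T. \<nu> y * (blinfun_apply v y)\<^sup>2)"
  proof (rule finite_minimax[OF U(1), of "cball 0 1" "\<lambda>y v. (blinfun_apply v y)\<^sup>2" c "3 * c / 4"])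
    show "3 * c / 4 < c" using c by simp
    show "0 \<le> (blinfun_apply v y)\<^sup>2 \<and> (blinfun_apply v y)\<^sup>2 \<le> 1" if "y \<in> cball 0 1" "v \<in> U" for y v
      using that U(2) ball[of y v] by (auto simp: S_def abs_square_le_1)
  next
    fix l :: "('a \<Rightarrow>\<^sub>L real) \<Rightarrow> real"
    assume l: "\<And>v. v \<in> U \<Longrightarrow> 0 \<le> l v" "0 < sum l U"
    \<comment> \<open>The negated claim, applied to \<open>U\<close> and the weights
      \<open>l\<close>, is exactly the hypothesis of the minimax lemma.\<close>
    have "U \<subseteq> sphere 0 1" using U(2) by (auto simp: S_def)
    with notthesis result[OF U(1) _ l] obtain y where "norm y \<le> 1"
      "c * sum l U < (\<Sum>v\<in>U. l v * (blinfun_apply v y)\<^sup>2)" by (meson not_less)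
    then show "\<exists>y\<in>cball 0 1. c * sum l U \<le> (\<Sum>v\<in>U. l v * (blinfun_apply v y)\<^sup>2)"
      by (intro bexI[of _ y]) auto
  qed auto
  \<comment> \<open>The inner product of \<open>L\<^sub>2 \<nu>\<close>, with functionals regarded
    as functions on \<open>T\<close>.\<close>
  define b where "b v w = (\<Sum>y\<in>T. \<nu> y * (blinfun_apply v y * blinfun_apply w y))"
    for v w :: "'a \<Rightarrow>\<^sub>L real"
  have lin: "linear (b v)" for v
    by (rule linearI) (simp_all add: b_def blinfun.add_left blinfun.scaleR_left algebra_simps
        sum.distrib sum_distrib_left)
  have sym: "b v w = b w v" for v w by (simp add: b_def mult.commute)
  have unit: "c / 2 \<le> b v v" if v: "v \<in> E" "norm v = 1" for v
  proof -
    have "\<bar>blinfun_apply v (x k)\<bar> \<le> norm (x k)" for k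
      using norm_blinfun[of v "x k"] v by simp
    with E_repr[OF v(1)] v(2) have "v \<in> S" unfolding S_def by auto
    then obtain w where w: "w \<in> U" "norm (w - v) < c / 8" using U(3) by (auto simp: dist_norm)
    have nw: "norm w = 1" using w U(2) by (auto simp: S_def)
    have "(blinfun_apply w y)\<^sup>2 - c / 4 \<le> (blinfun_apply v y)\<^sup>2" if "y \<in> T" for y
    proof -
      have y: "norm y \<le> 1" using T(2) that by auto
      have "(blinfun_apply w y)\<^sup>2 - (blinfun_apply v y)\<^sup>2 =
          blinfun_apply (w + v) y * blinfun_apply (w - v) y"
        by (simp add: power2_eq_square blinfun.add_left blinfun.diff_left algebra_simps)
      also have "\<dots> \<le> \<bar>blinfun_apply (w + v) y\<bar> * \<bar>blinfun_apply (w - v) y\<bar>"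
        by (metis abs_ge_self abs_mult)
      also have "\<dots> \<le> 2 * (c / 8)"
      proof (rule mult_mono)
        show "\<bar>blinfun_apply (w + v) y\<bar> \<le> 2"
          using ball[OF y, of "w + v"] norm_triangle_ineq[of w v] nw v by simp
        show "\<bar>blinfun_apply (w - v) y\<bar> \<le> c / 8" using ball[OF y, of "w - v"] w by simp
      qed auto
      finally show ?thesis by simp
    qed
    then have "(\<Sum>y\<in>T. \<nu> y * ((blinfun_apply w y)\<^sup>2 - c / 4)) \<le> (\<Sum>y\<in>T. \<nu> y * (blinfun_apply v y)\<^sup>2)"
      using T by (intro sum_mono mult_left_mono) auto
    also have "\<dots> = b v v" by (simp add: b_def power2_eq_square)
    finally have "(\<Sum>y\<in>T. \<nu> y * (blinfun_apply w y)\<^sup>2) - sum \<nu> T * (c / 4) \<le> b v v"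
      by (simp add: right_diff_distrib sum_subtractf sum_distrib_right sum_divide_distrib)
    with dom[OF w(1)] T(4) show ?thesis by simp
  qed
  have low: "c / 2 * (norm v)\<^sup>2 \<le> b v v" if "v \<in> E" for v
  proof (cases "v = 0")
    case False
    define w where "w = v /\<^sub>R norm v"
    have "v = norm v *\<^sub>R w" using False by (simp add: w_def)
    then have "b v v = norm v * b v w" using linear_scale[OF lin, of v "norm v" w] by simp
    also have "b v w = b w v" by (rule sym)
    also have "\<dots> = norm v * b w w"
      using \<open>v = norm v *\<^sub>R w\<close> linear_scale[OF lin, of w "norm v" w] by simp
    finally have "b v v = (norm v)\<^sup>2 * b w w" by (simp add: power2_eq_square)
    moreover have "c / 2 \<le> b w w"
      using that False by (intro unit) (auto simp: w_def E_def span_scale)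
    ultimately show ?thesis
      using mult_right_mono[of "c / 2" "b w w" "(norm v)\<^sup>2"] by (simp add: mult.commute)
  qed (simp add: linear_0[OF lin])
  have "\<exists>e. (\<forall>k<n. e k \<in> span (u ` {..<n})) \<and>
    (\<forall>j<n. \<forall>k<n. b (e j) (e k) = (if j = k then 1 else 0))"
  proof (rule gram_schmidt[OF lin sym])
    fix v assume "v \<in> span (u ` {..<n})" "v \<noteq> 0"
    with low[of v] c show "0 < b v v"
      by (smt (verit, ccfv_SIG) E_def divide_pos_pos mult_pos_pos zero_less_norm_iff zero_less_power)
  next
    fix k assume k: "k < n"
    have "blinfun_apply v (x k) = 0" if "v \<in> span (u ` {..<k})" for v
      using that
    proof (induction rule: span_induct_alt)
      case (step t w v)
      then show ?case using xu k by (auto simp: blinfun.add_left blinfun.scaleR_left)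
    qed simp
    with xu[OF k k] show "u k \<notin> span (u ` {..<k})" by force
  qed
  then obtain e where e: "\<And>k. k < n \<Longrightarrow> e k \<in> E"
    and on: "\<And>j k. j < n \<Longrightarrow> k < n \<Longrightarrow> b (e j) (e k) = (if j = k then 1 else 0)"
    unfolding E_def by blast
  have bound: "(\<Sum>k<n. (blinfun_apply (e k) y)\<^sup>2) \<le> 2 / c" if "y \<in> T" for y
  proof -
    define s where "s = (\<Sum>k<n. (blinfun_apply (e k) y)\<^sup>2)"
    \<comment> \<open>\<open>w\<close> represents evaluation at \<open>y\<close> on \<open>E\<close>
      with respect to \<open>b\<close>. Hence \<open>s\<close> equals both \<open>w y\<close>, which
      is at most \<open>norm w\<close>, and \<open>b w w\<close>, which is at least
      \<open>c / 2 * (norm w)\<^sup>2\<close>; together they bound \<open>s\<close>.\<close>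
    define w where "w = (\<Sum>k<n. blinfun_apply (e k) y *\<^sub>R e k)"
    have "s = blinfun_apply w y"
      by (simp add: s_def w_def blinfun.sum_left blinfun.scaleR_left power2_eq_square)
    also have "\<dots> \<le> norm w" using ball[of y w] that T(2) by auto
    finally have sw: "s \<le> norm w" .
    have s0: "0 \<le> s" by (simp add: s_def sum_nonneg)
    have be: "b (e j) w = blinfun_apply (e j) y" if "j < n" for j
      using that by (simp add: w_def linear_sum[OF lin] linear_scale[OF lin] on
        if_distrib[of "\<lambda>t. _ * t"] cong: if_cong)
    have "b w w = (\<Sum>k<n. blinfun_apply (e k) y * b w (e k))"
      by (subst (2) w_def) (simp add: linear_sum[OF lin] linear_scale[OF lin])
    also have "\<dots> = s"
      unfolding s_def by (rule sum.cong) (use be sym in \<open>auto simp: power2_eq_square\<close>)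
    finally have "b w w = s" .
    moreover have "w \<in> E" unfolding w_def E_def by (intro span_sum span_scale) (use e E_def in auto)
    ultimately have "c / 2 * (norm w)\<^sup>2 \<le> s" using low by metis
    moreover have "c / 2 * s\<^sup>2 \<le> c / 2 * (norm w)\<^sup>2"
      using sw s0 c by (intro mult_left_mono power_mono) auto
    ultimately have "c / 2 * s * s \<le> 1 * s" by (simp add: power2_eq_square)
    then have "c / 2 * s \<le> 1" using s0 mult_right_le_imp_le[of "c / 2 * s" s 1] by fastforce
    then show ?thesis using c unfolding s_def[symmetric] by (simp add: field_simps)
  qed
  \<comment> \<open>The dimension is the trace of the form, and interchanging the sums turns it into
    a \<open>\<nu>\<close>-average of the pointwise bound.\<close>
  have "real n = (\<Sum>k<n. b (e k) (e k))" by (simp add: on)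
  also have "\<dots> = (\<Sum>y\<in>T. \<nu> y * (\<Sum>k<n. (blinfun_apply (e k) y)\<^sup>2))"
    unfolding b_def by (subst sum.swap) (simp add: sum_distrib_left power2_eq_square)
  also have "\<dots> \<le> (\<Sum>y\<in>T. \<nu> y * (2 / c))"
    using T bound by (intro sum_mono mult_left_mono) auto
  also have "\<dots> = 2 / c" using T(4) by (simp flip: sum_divide_distrib sum_distrib_right)
  finally show False using n by simp
qed

subsection \<open>Weak \<open>p\<close>-norms and the lattice \<open>FBL\<close>\<close>

lemma powr_add_bound:
  fixes a b p :: real
  assumes "0 \<le> a" "0 \<le> b" "0 \<le> p"
  shows "(a + b) powr p \<le> 2 powr p * (a powr p + b powr p)"
proof -
  have "(a + b) powr p \<le> (2 * max a b) powr p" using assms by (intro powr_mono2) auto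
  also have "\<dots> = 2 powr p * max a b powr p" by (simp add: powr_mult)
  also have "\<dots> \<le> 2 powr p * (a powr p + b powr p)"
    by (intro mult_left_mono) (auto simp: max_def)
  finally show ?thesis .
qed

text \<open>Young's inequality after scaling \<open>b\<close> to \<open>p\<close>-norm 1. The
  exponent \<open>p = 1\<close> is separate because its dual norm is a maximum.\<close>

lemma lq_norm_Holder:
  assumes p: "1 \<le> p" and \<alpha>: "lq_norm (conj_exponent p) n \<alpha> \<le> 1" and b: "\<And>k. 0 \<le> b k"
  shows "(\<Sum>k = 1..n. \<bar>\<alpha> k\<bar> * b k) \<le> (\<Sum>k = 1..n. b k powr p) powr (1 / p)"
proof (cases "p = 1")
  case True
  then have "Max (insert 0 ((\<lambda>k. \<bar>\<alpha> k\<bar>) ` {1..n})) \<le> 1"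
    using \<alpha> by (simp add: conj_exponent_def lq_norm_def)
  then have "\<bar>\<alpha> k\<bar> \<le> 1" if "k \<in> {1..n}" for k
    using that by (subst (asm) Max_le_iff) auto
  then have "(\<Sum>k = 1..n. \<bar>\<alpha> k\<bar> * b k) \<le> (\<Sum>k = 1..n. 1 * b k)"
    using b by (intro sum_mono mult_right_mono) auto
  with True b show ?thesis by (simp add: sum_nonneg)
next
  case False
  then have p: "1 < p" using p by simp
  define q where "q = p / (p - 1)"
  have q: "1 < q" "1 / q + 1 / p = 1" using p by (auto simp: q_def field_simps)
  have "(\<Sum>k = 1..n. \<bar>\<alpha> k\<bar> powr q) powr (1 / q) \<le> 1"
    using \<alpha> False by (simp add: conj_exponent_def lq_norm_def q_def)
  then have \<alpha>1: "(\<Sum>k = 1..n. \<bar>\<alpha> k\<bar> powr q) \<le> 1"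
    using q by (smt (verit) divide_pos_pos gr_one_powr)
  define S where "S = (\<Sum>k = 1..n. b k powr p)"
  have S0: "0 \<le> S" by (simp add: S_def sum_nonneg)
  show ?thesis
  proof (cases "S = 0")
    case True
    then have "\<forall>k\<in>{1..n}. b k powr p = 0"
      unfolding S_def by (subst (asm) sum_nonneg_eq_0_iff) auto
    then show ?thesis by (simp add: True S_def[symmetric])
  next
    case False
    define s where "s = S powr (1 / p)"
    have s: "0 < s" "s powr p = S" using False S0 p by (auto simp: s_def powr_powr)
    have "(\<Sum>k = 1..n. \<bar>\<alpha> k\<bar> * (b k / s)) \<le>
      (\<Sum>k = 1..n. \<bar>\<alpha> k\<bar> powr q / q + (b k / s) powr p / p)"
      using b s p q by (intro sum_mono Youngs_inequality) auto
    also have "\<dots> = (\<Sum>k = 1..n. \<bar>\<alpha> k\<bar> powr q) / q + (\<Sum>k = 1..n. b k powr p) / S / p"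
      using b s by (simp add: sum.distrib sum_divide_distrib powr_divide)
    also have "\<dots> \<le> 1 / q + 1 / p"
      using \<alpha>1 q p False
      by (intro add_mono divide_right_mono) (auto simp: S_def)
    finally have "(\<Sum>k = 1..n. \<bar>\<alpha> k\<bar> * b k) / s \<le> 1"
      using q by (simp add: sum_divide_distrib)
    then show ?thesis using s(1) unfolding s_def S_def by (simp add: divide_le_eq)
  qed
qed

text \<open>The extremal sequence is the signed power \<open>\<bar>b k\<bar> powr (p - 1)\<close>,
  normalised; for \<open>p = 1\<close> it is the sign of \<open>b k\<close>, and for vanishing
  \<open>b\<close> the zero sequence does.\<close>

lemma lq_norm_Holder_equality:
  assumes p: "1 \<le> p"
  obtains \<alpha> where "lq_norm (conj_exponent p) n \<alpha> \<le> 1"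
    "(\<Sum>k = 1..n. \<bar>b k\<bar> powr p) powr (1 / p) = (\<Sum>k = 1..n. \<alpha> k * b k)"
proof (cases "p = 1")
  case True
  have "Max (insert 0 ((\<lambda>k. \<bar>sgn (b k)\<bar>) ` {1..n})) \<le> 1"
    by (subst Max_le_iff) (auto simp: sgn_if)
  moreover have "(\<Sum>k = 1..n. sgn (b k) * b k) = (\<Sum>k = 1..n. \<bar>b k\<bar>)"
    by (rule sum.cong) (auto simp: sgn_if)
  ultimately show ?thesis
    using True that[of "\<lambda>k. sgn (b k)"] by (simp add: conj_exponent_def lq_norm_def sum_nonneg)
next
  case False
  then have p: "1 < p" using p by simp
  define q where "q = p / (p - 1)"
  have q: "1 < q" "(p - 1) * q = p" "1 - 1 / q = 1 / p" using p by (auto simp: q_def field_simps)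
  define S where "S = (\<Sum>k = 1..n. \<bar>b k\<bar> powr p)"
  have S0: "0 \<le> S" by (simp add: S_def sum_nonneg)
  have lq: "lq_norm (conj_exponent p) n \<alpha> = (\<Sum>k = 1..n. \<bar>\<alpha> k\<bar> powr q) powr (1 / q)" for \<alpha>
    using False by (simp add: conj_exponent_def lq_norm_def q_def)
  show ?thesis
  proof (cases "S = 0")
    case True
    show ?thesis by (rule that[of "\<lambda>_. 0"]) (use True in \<open>simp_all add: lq S_def\<close>)
  next
    case False
    then have S: "0 < S" using S0 by simp
    define \<alpha> where "\<alpha> k = sgn (b k) * \<bar>b k\<bar> powr (p - 1) / S powr (1 / q)" for k
    have abs_\<alpha>: "\<bar>\<alpha> k\<bar> = \<bar>b k\<bar> powr (p - 1) / S powr (1 / q)" for k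
      by (cases "b k = 0") (auto simp: \<alpha>_def abs_mult abs_sgn_eq)
    have "\<bar>\<alpha> k\<bar> powr q = \<bar>b k\<bar> powr p / S" for k
      unfolding abs_\<alpha> using S q by (simp add: powr_divide powr_powr)
    then have one: "(\<Sum>k = 1..n. \<bar>\<alpha> k\<bar> powr q) = 1"
      using S by (simp add: S_def flip: sum_divide_distrib)
    have "\<alpha> k * b k = \<bar>b k\<bar> powr p / S powr (1 / q)" for k
    proof -
      have "\<alpha> k * b k = \<bar>b k\<bar> powr (p - 1) * \<bar>b k\<bar> powr 1 / S powr (1 / q)"
        by (simp add: \<alpha>_def sgn_if)
      also have "\<dots> = \<bar>b k\<bar> powr p / S powr (1 / q)"
        by (subst powr_add[symmetric]) simp
      finally show ?thesis .
    qed
    then have "(\<Sum>k = 1..n. \<alpha> k * b k) = S powr 1 / S powr (1 / q)"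
      using S by (simp add: S_def flip: sum_divide_distrib)
    also have "\<dots> = S powr (1 / p)" unfolding powr_diff[symmetric] q(3) ..
    finally show ?thesis
      using that[of \<alpha>] unfolding lq one by (simp add: S_def)
  qed
qed

text \<open>By Hoelder, each combination of the functionals is controlled pointwise. The weak norm
  in the dual can thus be estimated by testing against the unit ball of the space itself, with no
  recourse to the bidual.\<close>

lemma weak_p_norm_le:
  fixes z :: "nat \<Rightarrow> 'a::real_normed_vector \<Rightarrow>\<^sub>L real"
  assumes p: "1 \<le> p"
    and M: "\<And>y. norm y \<le> 1 \<Longrightarrow> (\<Sum>k = 1..n. \<bar>blinfun_apply (z k) y\<bar> powr p) \<le> M"
  shows "weak_p_norm p n z \<le> M powr (1 / p)"
  unfolding weak_p_norm_def
proof (rule cSup_least)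
  \<comment> \<open>Any admissible \<open>\<alpha>\<close> shows that the supremum is over a
    nonempty set; duality for the zero sequence supplies one.\<close>
  obtain \<alpha> where "lq_norm (conj_exponent p) n \<alpha> \<le> 1"
    using lq_norm_Holder_equality[OF p, of n "\<lambda>_. 0"] by blast
  then show "{norm (\<Sum>k = 1..n. \<alpha> k *\<^sub>R z k) |\<alpha>. lq_norm (conj_exponent p) n \<alpha> \<le> 1} \<noteq> {}"
    by blast
next
  fix r assume "r \<in> {norm (\<Sum>k = 1..n. \<alpha> k *\<^sub>R z k) |\<alpha>. lq_norm (conj_exponent p) n \<alpha> \<le> 1}"
  then obtain \<alpha> where r: "r = norm (\<Sum>k = 1..n. \<alpha> k *\<^sub>R z k)"
    and \<alpha>: "lq_norm (conj_exponent p) n \<alpha> \<le> 1" by blast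
  have unit: "\<bar>blinfun_apply (\<Sum>k = 1..n. \<alpha> k *\<^sub>R z k) y\<bar> \<le> M powr (1 / p)" if "norm y \<le> 1" for y
  proof -
    have "\<bar>blinfun_apply (\<Sum>k = 1..n. \<alpha> k *\<^sub>R z k) y\<bar> \<le> (\<Sum>k = 1..n. \<bar>\<alpha> k\<bar> * \<bar>blinfun_apply (z k) y\<bar>)"
      by (simp add: blinfun.sum_left blinfun.scaleR_left order_trans[OF sum_abs] abs_mult)
    also have "\<dots> \<le> (\<Sum>k = 1..n. \<bar>blinfun_apply (z k) y\<bar> powr p) powr (1 / p)"
      by (rule lq_norm_Holder[OF p \<alpha>]) simp
    also have "\<dots> \<le> M powr (1 / p)"
      using p M[OF that] by (intro powr_mono2) (auto intro: sum_nonneg)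
    finally show ?thesis .
  qed
  show "r \<le> M powr (1 / p)"
    unfolding r
  proof (rule norm_blinfun_bound)
    fix y :: 'a
    show "norm (blinfun_apply (\<Sum>k = 1..n. \<alpha> k *\<^sub>R z k) y) \<le> M powr (1 / p) * norm y"
      using unit[of "y /\<^sub>R norm y"]
      by (cases "y = 0") (simp_all add: blinfun.scaleR_right abs_mult field_simps)
  qed simp
qed

text \<open>The extremal \<open>\<alpha>\<close> rewrites the \<open>p\<close>-sum as the value at
  \<open>y\<close> of a single combination of the functionals, whose norm competes in the
  supremum.\<close>

lemma
  fixes z :: "nat \<Rightarrow> 'a::real_normed_vector \<Rightarrow>\<^sub>L real"
  assumes p: "1 \<le> p"
  shows sum_powr_eval_le: "(\<Sum>k = 1..n. \<bar>blinfun_apply (z k) y\<bar> powr p) powr (1 / p)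
      \<le> norm y * weak_p_norm p n z"
    and weak_p_norm_nonneg: "0 \<le> weak_p_norm p n z"
proof -
  let ?S = "{norm (\<Sum>k = 1..n. \<alpha> k *\<^sub>R z k) |\<alpha>. lq_norm (conj_exponent p) n \<alpha> \<le> 1}"
  \<comment> \<open>Hoelder with the norms of \<open>z k\<close> keeps the real supremum from being
    taken over an unbounded set.\<close>
  have bdd: "bdd_above ?S"
  proof (rule bdd_aboveI)
    fix r assume "r \<in> ?S"
    then obtain \<alpha> where r: "r = norm (\<Sum>k = 1..n. \<alpha> k *\<^sub>R z k)"
      and \<alpha>: "lq_norm (conj_exponent p) n \<alpha> \<le> 1" by blast
    have "r \<le> (\<Sum>k = 1..n. \<bar>\<alpha> k\<bar> * norm (z k))"
      unfolding r by (rule order_trans[OF norm_sum]) simp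
    also have "\<dots> \<le> (\<Sum>k = 1..n. norm (z k) powr p) powr (1 / p)"
      by (rule lq_norm_Holder[OF p \<alpha>]) simp
    finally show "r \<le> (\<Sum>k = 1..n. norm (z k) powr p) powr (1 / p)" .
  qed
  obtain \<alpha> where \<alpha>: "lq_norm (conj_exponent p) n \<alpha> \<le> 1"
    and eq: "(\<Sum>k = 1..n. \<bar>blinfun_apply (z k) y\<bar> powr p) powr (1 / p)
      = (\<Sum>k = 1..n. \<alpha> k * blinfun_apply (z k) y)"
    using lq_norm_Holder_equality[OF p, of n "\<lambda>k. blinfun_apply (z k) y"] .
  have le: "norm (\<Sum>k = 1..n. \<alpha> k *\<^sub>R z k) \<le> weak_p_norm p n z"
    unfolding weak_p_norm_def by (rule cSup_upper[OF _ bdd]) (use \<alpha> in blast)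
  then show "0 \<le> weak_p_norm p n z" by (rule order_trans[OF norm_ge_zero])
  note eq
  also have "(\<Sum>k = 1..n. \<alpha> k * blinfun_apply (z k) y) = blinfun_apply (\<Sum>k = 1..n. \<alpha> k *\<^sub>R z k) y"
    by (simp add: blinfun.sum_left blinfun.scaleR_left)
  also have "\<dots> \<le> norm (\<Sum>k = 1..n. \<alpha> k *\<^sub>R z k) * norm y"
    using norm_blinfun[of "\<Sum>k = 1..n. \<alpha> k *\<^sub>R z k" y] by simp
  also have "\<dots> \<le> weak_p_norm p n z * norm y" by (intro mult_right_mono le) simp
  finally show "(\<Sum>k = 1..n. \<bar>blinfun_apply (z k) y\<bar> powr p) powr (1 / p)
      \<le> norm y * weak_p_norm p n z" by (simp add: mult.commute)
qed

section \<open>Admissible real constants behind \<open>fbl_norm\<close>\<close>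

definition fbl_bound :: "real \<Rightarrow> (('a::real_normed_vector \<Rightarrow>\<^sub>L real) \<Rightarrow> real) \<Rightarrow> real \<Rightarrow> bool" where
  "fbl_bound p f C \<longleftrightarrow> 0 \<le> C \<and>
     (\<forall>n x. (\<Sum>k = 1..n. \<bar>f (x k)\<bar> powr p) powr (1 / p) \<le> C * weak_p_norm p n x)"

lemma fbl_norm_le: "fbl_bound p f C \<Longrightarrow> fbl_norm p f \<le> ennreal C"
  unfolding fbl_norm_def fbl_bound_def by (rule Inf_lower) blast

lemma fbl_norm_lessE:
  assumes "fbl_norm p f < ennreal e"
  obtains C where "fbl_bound p f C" "C < e"
  using assms unfolding fbl_norm_def fbl_bound_def Inf_less_iff by (auto simp: ennreal_less_iff)

lemma fbl_norm_less_topE: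
  assumes "fbl_norm p f < top"
  obtains C where "fbl_bound p f C"
  using assms unfolding fbl_norm_def fbl_bound_def Inf_less_iff by auto

lemma fbl_bound_imp_less_top: "fbl_bound p f C \<Longrightarrow> fbl_norm p f < top"
  using fbl_norm_le[of p f C] by (simp add: le_less_trans)

lemma fbl_bound_powr:
  assumes p: "1 \<le> p" and f: "fbl_bound p f C"
  shows "(\<Sum>k = 1..n. \<bar>f (x k)\<bar> powr p) \<le> (C * weak_p_norm p n x) powr p"
proof -
  have "((\<Sum>k = 1..n. \<bar>f (x k)\<bar> powr p) powr (1 / p)) powr p \<le> (C * weak_p_norm p n x) powr p"
    using f p unfolding fbl_bound_def by (intro powr_mono2) auto
  then show ?thesis using p by (simp add: powr_powr sum_nonneg)
qed

text \<open>Only finiteness matters, so a crude factor 4 stands in for the sharp triangle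
  inequality. Assuming mere domination of \<open>h\<close> covers sums, maxima and minima
  together.\<close>

lemma fbl_bound_add:
  assumes p: "1 \<le> p" and f: "fbl_bound p f C" and g: "fbl_bound p g D"
    and h: "\<And>x. \<bar>h x\<bar> \<le> \<bar>f x\<bar> + \<bar>g x\<bar>"
  shows "fbl_bound p h (4 * (C + D))"
  unfolding fbl_bound_def
proof (intro conjI allI)
  have CD: "0 \<le> C" "0 \<le> D" using f g by (auto simp: fbl_bound_def)
  then show "0 \<le> 4 * (C + D)" by simp
  fix n and x :: "nat \<Rightarrow> 'a \<Rightarrow>\<^sub>L real"
  let ?W = "weak_p_norm p n x"
  have W: "0 \<le> ?W" by (rule weak_p_norm_nonneg[OF p])
  have "(\<Sum>k = 1..n. \<bar>h (x k)\<bar> powr p) \<le>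
    (\<Sum>k = 1..n. 2 powr p * (\<bar>f (x k)\<bar> powr p + \<bar>g (x k)\<bar> powr p))"
    using p h by (intro sum_mono order_trans[OF powr_mono2 powr_add_bound]) auto
  also have "\<dots> = 2 powr p * ((\<Sum>k = 1..n. \<bar>f (x k)\<bar> powr p) + (\<Sum>k = 1..n. \<bar>g (x k)\<bar> powr p))"
    by (simp only: sum_distrib_left[symmetric] sum.distrib)
  also have "\<dots> \<le> 2 powr p * (((C + D) * ?W) powr p + ((C + D) * ?W) powr p)"
    using CD W p
    by (intro mult_left_mono add_mono order_trans[OF fbl_bound_powr[OF p f]]
        order_trans[OF fbl_bound_powr[OF p g]] powr_mono2 mult_right_mono) auto
  also have "\<dots> \<le> 2 powr p * (2 powr p * ((C + D) * ?W) powr p)"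
    using powr_mono[of 1 p 2] p by (intro mult_left_mono) (auto simp: mult_right_mono)
  also have "\<dots> = (4 * (C + D) * ?W) powr p"
  proof -
    have "4 * (C + D) * ?W = 2 * (2 * ((C + D) * ?W))" by simp
    then show ?thesis by (simp only: powr_mult)
  qed
  finally have "(\<Sum>k = 1..n. \<bar>h (x k)\<bar> powr p) powr (1 / p) \<le> ((4 * (C + D) * ?W) powr p) powr (1 / p)"
    using p by (intro powr_mono2) (auto intro: sum_nonneg)
  also have "\<dots> = 4 * (C + D) * ?W"
    using p CD W by (simp add: powr_powr)
  finally show "(\<Sum>k = 1..n. \<bar>h (x k)\<bar> powr p) powr (1 / p) \<le> 4 * (C + D) * ?W" .
qed

lemma fbl_bound_scale:
  assumes p: "1 \<le> p" and f: "fbl_bound p f C"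
  shows "fbl_bound p (\<lambda>x. c * f x) (\<bar>c\<bar> * C)"
  unfolding fbl_bound_def
proof (intro conjI allI)
  show "0 \<le> \<bar>c\<bar> * C" using f by (simp add: fbl_bound_def)
  fix n and x :: "nat \<Rightarrow> 'a \<Rightarrow>\<^sub>L real"
  have "(\<Sum>k = 1..n. \<bar>c * f (x k)\<bar> powr p) powr (1 / p)
    = (\<bar>c\<bar> powr p * (\<Sum>k = 1..n. \<bar>f (x k)\<bar> powr p)) powr (1 / p)"
    by (simp add: abs_mult powr_mult sum_distrib_left)
  also have "\<dots> = \<bar>c\<bar> * (\<Sum>k = 1..n. \<bar>f (x k)\<bar> powr p) powr (1 / p)"
    using p by (simp add: powr_mult powr_powr)
  also have "\<dots> \<le> \<bar>c\<bar> * (C * weak_p_norm p n x)"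
    using f by (intro mult_left_mono) (auto simp: fbl_bound_def)
  finally show "(\<Sum>k = 1..n. \<bar>c * f (x k)\<bar> powr p) powr (1 / p) \<le> \<bar>c\<bar> * C * weak_p_norm p n x"
    by (simp add: mult_ac)
qed

lemma fbl_bound_delta: "1 \<le> p \<Longrightarrow> fbl_bound p (delta y) (norm y)"
  using sum_powr_eval_le unfolding fbl_bound_def delta_def by auto

lemma fbl_bound_zero: "1 \<le> p \<Longrightarrow> fbl_bound p (\<lambda>_. 0) 0"
  by (simp add: fbl_bound_def)

section \<open>Lattice operations in \<open>H_wstar\<close> and \<open>Hp_wstar\<close>\<close>

lemma H_wstarI:
  assumes "\<And>c x. 0 \<le> c \<Longrightarrow> f (c *\<^sub>R x) = c * f x"
    and "\<And>B. bounded B \<Longrightarrow> continuous_map (subtopology weak_star_topology B) euclideanreal f"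
  shows "f \<in> H_wstar"
  using assms by (simp add: H_wstar_def)

lemma H_wstar_scaleR: "f \<in> H_wstar \<Longrightarrow> 0 \<le> c \<Longrightarrow> f (c *\<^sub>R x) = c * f x"
  by (simp add: H_wstar_def)

lemma H_wstar_continuous:
  "f \<in> H_wstar \<Longrightarrow> bounded B \<Longrightarrow> continuous_map (subtopology weak_star_topology B) euclideanreal f"
  by (simp add: H_wstar_def)

lemma delta_in_H_wstar: "delta y \<in> H_wstar"
  by (rule H_wstarI)
    (auto simp: delta_def blinfun.scaleR_left
      intro: continuous_map_from_subtopology strong_operator_topology_continuous_evaluation)

lemma zero_in_H_wstar: "(\<lambda>_. 0) \<in> H_wstar"
  by (rule H_wstarI) auto

lemma H_wstar_add: "f \<in> H_wstar \<Longrightarrow> g \<in> H_wstar \<Longrightarrow> (\<lambda>t. f t + g t) \<in> H_wstar"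
  by (rule H_wstarI) (auto simp: H_wstar_scaleR H_wstar_continuous algebra_simps intro!: continuous_intros)

lemma H_wstar_scale: "f \<in> H_wstar \<Longrightarrow> (\<lambda>t. c * f t) \<in> H_wstar"
  by (rule H_wstarI) (auto simp: H_wstar_scaleR H_wstar_continuous intro!: continuous_intros)

lemma H_wstar_max: "f \<in> H_wstar \<Longrightarrow> g \<in> H_wstar \<Longrightarrow> (\<lambda>t. max (f t) (g t)) \<in> H_wstar"
  by (rule H_wstarI)
    (auto simp: H_wstar_scaleR H_wstar_continuous max_mult_distrib_left intro!: continuous_intros)

lemma H_wstar_min: "f \<in> H_wstar \<Longrightarrow> g \<in> H_wstar \<Longrightarrow> (\<lambda>t. min (f t) (g t)) \<in> H_wstar"
  by (rule H_wstarI)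
    (auto simp: H_wstar_scaleR H_wstar_continuous min_mult_distrib_left intro!: continuous_intros)

lemma vector_sublattice_H_wstar: "vector_sublattice H_wstar H_wstar"
  unfolding vector_sublattice_def fun_subspace_def
  by (intro conjI ballI allI subset_refl zero_in_H_wstar H_wstar_add H_wstar_scale H_wstar_max H_wstar_min)

lemma vector_sublattice_Hp_wstar:
  assumes p: "1 \<le> p"
  shows "vector_sublattice H_wstar (Hp_wstar p)"
proof -
  have comb: "h \<in> Hp_wstar p"
    if fg: "f \<in> Hp_wstar p" "g \<in> Hp_wstar p" and h: "h \<in> H_wstar"
      and le: "\<And>x. \<bar>h x\<bar> \<le> \<bar>f x\<bar> + \<bar>g x\<bar>"
    for f g h :: "('a \<Rightarrow>\<^sub>L real) \<Rightarrow> real"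
  proof -
    obtain C D where "fbl_bound p f C" "fbl_bound p g D"
      using fg unfolding Hp_wstar_def by (auto elim!: fbl_norm_less_topE)
    then have "fbl_norm p h < top"
      using le by (rule fbl_bound_imp_less_top[OF fbl_bound_add[OF p]])
    with h show ?thesis by (simp add: Hp_wstar_def)
  qed
  have scale: "(\<lambda>t. c * f t) \<in> Hp_wstar p" if "f \<in> Hp_wstar p"
    for c and f :: "('a \<Rightarrow>\<^sub>L real) \<Rightarrow> real"
    using that fbl_bound_scale[OF p] unfolding Hp_wstar_def
    by (auto elim!: fbl_norm_less_topE intro: fbl_bound_imp_less_top H_wstar_scale)
  have zero: "(\<lambda>_. 0) \<in> Hp_wstar p"
    using fbl_bound_imp_less_top[OF fbl_bound_zero[OF p]] by (simp add: Hp_wstar_def zero_in_H_wstar)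
  have sub: "Hp_wstar p \<subseteq> H_wstar" by (auto simp: Hp_wstar_def)
  show ?thesis
    unfolding vector_sublattice_def fun_subspace_def
  proof (intro conjI ballI allI zero scale sub)
    fix f g :: "('a \<Rightarrow>\<^sub>L real) \<Rightarrow> real"
    assume fg: "f \<in> Hp_wstar p" "g \<in> Hp_wstar p"
    then have H: "f \<in> H_wstar" "g \<in> H_wstar" using sub by auto
    show "(\<lambda>t. f t + g t) \<in> Hp_wstar p" by (rule comb[OF fg H_wstar_add[OF H]]) simp
    show "(\<lambda>t. max (f t) (g t)) \<in> Hp_wstar p" by (rule comb[OF fg H_wstar_max[OF H]]) auto
    show "(\<lambda>t. min (f t) (g t)) \<in> Hp_wstar p" by (rule comb[OF fg H_wstar_min[OF H]]) auto
  qed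
qed

section \<open>The lattice generated by the evaluations\<close>

lemma vector_sublattice_FVL: "vector_sublattice H_wstar (FVL :: (('a::real_normed_vector \<Rightarrow>\<^sub>L real) \<Rightarrow> real) set)"
proof -
  have "FVL \<subseteq> (H_wstar :: (('a \<Rightarrow>\<^sub>L real) \<Rightarrow> real) set)"
    unfolding FVL_def by (rule hull_minimal) (auto simp: delta_in_H_wstar vector_sublattice_H_wstar)
  then show ?thesis
    unfolding FVL_def hull_def vector_sublattice_def fun_subspace_def by auto
qed

lemma delta_in_FVL: "delta y \<in> FVL"
  unfolding FVL_def by (rule hull_inc) simp

lemma FVL_subset_Hp_wstar:
  assumes "1 \<le> p"
  shows "FVL \<subseteq> Hp_wstar p"
  unfolding FVL_def
  by (rule hull_minimal)
    (use assms in \<open>auto simp: Hp_wstar_def delta_in_H_wstar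
      intro: fbl_bound_imp_less_top fbl_bound_delta vector_sublattice_Hp_wstar[unfolded Hp_wstar_def]\<close>)

lemma FVL_subset_FBL:
  assumes "1 \<le> p"
  shows "FVL \<subseteq> FBL p"
proof
  fix f :: "('a \<Rightarrow>\<^sub>L real) \<Rightarrow> real" assume f: "f \<in> FVL"
  have "fbl_norm p (\<lambda>t. f t - f t) \<le> 0"
    using fbl_norm_le[OF fbl_bound_zero[OF assms]] by (simp del: le_zero_eq)
  then have "fbl_norm p (\<lambda>t. f t - f t) < ennreal e" if "0 < e" for e
    using that by simp
  then show "f \<in> FBL p" using f FVL_subset_Hp_wstar[OF assms] unfolding FBL_def by blast
qed

lemma
  assumes "f \<in> FVL"
  shows FVL_scale: "(\<lambda>t. c * f t) \<in> FVL"
    and FVL_add: "g \<in> FVL \<Longrightarrow> (\<lambda>t. f t + g t) \<in> FVL"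
    and FVL_max: "g \<in> FVL \<Longrightarrow> (\<lambda>t. max (f t) (g t)) \<in> FVL"
  using vector_sublattice_FVL assms unfolding vector_sublattice_def fun_subspace_def by blast+

lemma zero_in_FVL: "(\<lambda>_. 0) \<in> FVL"
  using vector_sublattice_FVL unfolding vector_sublattice_def fun_subspace_def by blast

lemma FVL_abs: "f \<in> FVL \<Longrightarrow> (\<lambda>t. \<bar>f t\<bar>) \<in> FVL"
proof -
  assume f: "f \<in> FVL"
  have "(\<lambda>t. \<bar>f t\<bar>) = (\<lambda>t. max (f t) (- 1 * f t))" by (auto simp: max_def)
  then show ?thesis using FVL_max[OF f FVL_scale[OF f, of "- 1"]] by simp
qed

text \<open>These are the building blocks of the seminorm \<open>w\<close>.\<close>

lemma FVL_Max_abs: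
  assumes "finite V" "V \<noteq> {}"
  shows "(\<lambda>x. Max ((\<lambda>v. \<bar>blinfun_apply x v\<bar>) ` V)) \<in> FVL"
  using assms
proof (induction rule: finite_ne_induct)
  case (singleton v)
  then show ?case using FVL_abs[OF delta_in_FVL[of v]] by (simp add: delta_def)
next
  case (insert v V)
  then show ?case using FVL_max[OF FVL_abs[OF delta_in_FVL[of v]] insert.IH] by (simp add: delta_def)
qed

text \<open>The functions depending on finitely many evaluations form a vector sublattice that
  contains every \<open>delta v\<close>, hence the generated one.\<close>

lemma FVL_finite_support:
  assumes "f \<in> FVL"
  obtains F where "finite F" "\<And>x u. (\<forall>v\<in>F. blinfun_apply u v = 0) \<Longrightarrow> f (x + u) = f x"
proof -
  define P where "P f \<longleftrightarrow> (\<exists>F. finite F \<and> (\<forall>x u. (\<forall>v\<in>F. blinfun_apply u v = 0) \<longrightarrow> f (x + u) = f x))"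
    for f :: "('a \<Rightarrow>\<^sub>L real) \<Rightarrow> real"
  \<comment> \<open>One argument for an arbitrary pointwise operation \<open>c\<close>; scalar
    multiplication is the case where the second argument is ignored.\<close>
  have comb: "P (\<lambda>t. c (f t) (g t))" if f: "P f" and g: "P g" for f g and c :: "real \<Rightarrow> real \<Rightarrow> real"
  proof -
    obtain F G where "finite F" "finite G"
      and "\<And>x u. (\<forall>v\<in>F. blinfun_apply u v = 0) \<Longrightarrow> f (x + u) = f x"
      and "\<And>x u. (\<forall>v\<in>G. blinfun_apply u v = 0) \<Longrightarrow> g (x + u) = g x"
      using f g unfolding P_def by metis
    then show ?thesis unfolding P_def by (intro exI[of _ "F \<union> G"]) auto
  qed
  have const: "P (\<lambda>_. 0)" unfolding P_def by (intro exI[of _ "{}"]) auto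
  have delta: "P (delta v)" for v
    unfolding P_def by (intro exI[of _ "{v}"]) (auto simp: delta_def blinfun.add_left)
  have "FVL \<subseteq> {f \<in> H_wstar. P f}"
    unfolding FVL_def
  proof (rule hull_minimal)
    show "range delta \<subseteq> {f \<in> H_wstar. P f}" using delta delta_in_H_wstar by auto
    show "vector_sublattice H_wstar {f \<in> H_wstar. P f}"
      unfolding vector_sublattice_def fun_subspace_def
      using const zero_in_H_wstar H_wstar_add H_wstar_max H_wstar_min H_wstar_scale
        comb[of _ _ "(+)"] comb[of _ _ max] comb[of _ _ min] comb[of _ _ "\<lambda>s _. c * s" for c]
      by auto
  qed
  then show ?thesis using assms that unfolding P_def by blast
qed

subsection \<open>Seminorms that are not \<open>p\<close>-summing\<close>

text \<open>An error proportional to \<open>norm x\<close> is uniform on bounded sets, and uniform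
  limits preserve continuity.\<close>

lemma H_wstar_uniform_limit:
  fixes g :: "('a::real_normed_vector \<Rightarrow>\<^sub>L real) \<Rightarrow> real"
  assumes hom: "\<And>c x. 0 \<le> c \<Longrightarrow> g (c *\<^sub>R x) = c * g x" and f: "\<And>m. f m \<in> H_wstar"
    and close: "\<And>m x. \<bar>f m x - g x\<bar> \<le> \<epsilon> m * norm x" and \<epsilon>: "\<epsilon> \<longlonglongrightarrow> 0"
  shows "g \<in> H_wstar"
proof (rule H_wstarI[OF hom])
  fix B :: "('a \<Rightarrow>\<^sub>L real) set" assume B: "bounded B"
  then obtain r where r: "\<And>x. x \<in> B \<Longrightarrow> norm x \<le> r" "0 < r" by (auto simp: bounded_pos)
  have "continuous_map (subtopology weak_star_topology B) Met_TC.mtopology g"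
  proof (rule Met_TC.continuous_map_uniform_limit)
    show "\<forall>\<^sub>F m in sequentially. continuous_map (subtopology weak_star_topology B) Met_TC.mtopology (f m)"
      using H_wstar_continuous[OF f B] by simp
  next
    fix \<eta> :: real assume "0 < \<eta>"
    then have "\<forall>\<^sub>F m in sequentially. \<epsilon> m < \<eta> / r"
      using \<epsilon> r by (intro order_tendstoD(2)[of \<epsilon> 0]) auto
    then show "\<forall>\<^sub>F m in sequentially. \<forall>x\<in>topspace (subtopology weak_star_topology B).
        g x \<in> UNIV \<and> dist (f m x) (g x) < \<eta>"
    proof (rule eventually_mono, intro ballI conjI UNIV_I)
      fix m x assume m: "\<epsilon> m < \<eta> / r" and "x \<in> topspace (subtopology weak_star_topology B)"
      then have x: "x \<in> B" by simp
      \<comment> \<open>Truncation at 0 supplies the nonnegative factor needed for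
        monotonicity.\<close>
      have "\<epsilon> m * norm x \<le> max 0 (\<epsilon> m) * r"
        by (rule mult_mono) (use r x in auto)
      then have "\<bar>f m x - g x\<bar> \<le> max 0 (\<epsilon> m) * r" using close[of m x] by linarith
      moreover have "max 0 (\<epsilon> m) * r < \<eta>" using m r \<open>0 < \<eta>\<close> by (auto simp: max_def field_simps)
      ultimately show "dist (f m x) (g x) < \<eta>" by (simp add: dist_real_def)
    qed
  qed simp
  then show "continuous_map (subtopology weak_star_topology B) euclideanreal g" by simp
qed

text \<open>The adjoint maps bounded sets to bounded sets and is weak-* continuous, since evaluating
  \<open>y o\<^sub>L i\<close> at a point is evaluating \<open>y\<close> at its image.\<close>

lemma induced_hom_H_wstar:
  assumes f: "f \<in> H_wstar"
  shows "induced_hom i f \<in> H_wstar"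
proof (rule H_wstarI)
  show "induced_hom i f (c *\<^sub>R y) = c * induced_hom i f y" if "0 \<le> c" for c y
  proof -
    have "(c *\<^sub>R y) o\<^sub>L i = c *\<^sub>R (y o\<^sub>L i)" by (rule blinfun_eqI) (simp add: blinfun.scaleR_left)
    then show ?thesis using H_wstar_scaleR[OF f that] by (simp add: induced_hom_def)
  qed
next
  fix B :: "('b \<Rightarrow>\<^sub>L real) set" assume "bounded B"
  then obtain r where "\<And>y. y \<in> B \<Longrightarrow> norm y \<le> r" by (auto simp: bounded_iff)
  then have "norm (y o\<^sub>L i) \<le> r * norm i" if "y \<in> B" for y
    using norm_blinfun_compose[of y i] mult_right_mono[of "norm y" r "norm i"] that by fastforce
  then have bdd: "bounded ((\<lambda>y. y o\<^sub>L i) ` B)" by (auto simp: bounded_iff)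
  have "continuous_map (subtopology weak_star_topology B)
      (subtopology weak_star_topology ((\<lambda>y. y o\<^sub>L i) ` B)) (\<lambda>y. y o\<^sub>L i)"
    by (auto simp: continuous_map_in_subtopology continuous_on_strong_operator_topo_iff_coordinatewise
        intro: continuous_map_from_subtopology strong_operator_topology_continuous_evaluation)
  from continuous_map_compose[OF this H_wstar_continuous[OF f bdd]]
  show "continuous_map (subtopology weak_star_topology B) euclideanreal (induced_hom i f)"
    by (simp add: induced_hom_def o_def)
qed

section \<open>Weakly small families for general exponents\<close>

lemma ex_almost_norming:
  fixes u :: "'a::real_normed_vector \<Rightarrow>\<^sub>L real"
  obtains v where "norm v \<le> 1" "norm u / 2 \<le> \<bar>blinfun_apply u v\<bar>"
proof (rule ccontr)
  assume "\<not> thesis"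
  note result = this that
  then have less: "\<bar>blinfun_apply u v\<bar> < norm u / 2" if "norm v \<le> 1" for v
    using result that by (meson not_less)
  have "norm u \<le> norm u / 2"
  proof (rule norm_blinfun_bound)
    fix y
    show "norm (blinfun_apply u y) \<le> norm u / 2 * norm y"
      using less[of "y /\<^sub>R norm y"]
      by (cases "y = 0") (simp_all add: blinfun.scaleR_right abs_mult field_simps)
  qed simp
  with less[of 0] show False by simp
qed

text \<open>Reduces every exponent \<open>p\<close> to the exponent \<open>2\<close> of the Dvoretzky--Rogers theorem above.\<close>

lemma powr_le_linear_quadratic:
  fixes a p t :: real
  assumes "\<bar>a\<bar> \<le> 1" "1 \<le> p" "0 < t"
  shows "\<bar>a\<bar> powr p \<le> t + a\<^sup>2 / t"
proof -
  have "\<bar>a\<bar> powr p \<le> \<bar>a\<bar>"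
    using assms powr_le_one_le[of "\<bar>a\<bar>" p] by (cases "a = 0") auto
  moreover have "\<bar>a\<bar> * t \<le> t * t + a\<^sup>2"
  proof -
    have "2 * (\<bar>a\<bar> * t) \<le> t * t + a\<^sup>2"
      using sum_squares_ge_zero[of "\<bar>a\<bar> - t" 0] by (simp add: power2_eq_square algebra_simps)
    moreover have "0 \<le> \<bar>a\<bar> * t" using assms by simp
    ultimately show ?thesis by linarith
  qed
  then have "\<bar>a\<bar> \<le> t + a\<^sup>2 / t"
    using assms by (simp add: field_simps power2_eq_square)
  ultimately show ?thesis by linarith
qed

lemma dvoretzky_rogers_powr:
  assumes inf: "\<nexists>B :: 'a::real_normed_vector set. finite B \<and> span B = UNIV"
    and p: "1 \<le> p" and t: "0 < t"
  shows "\<exists>n (u :: nat \<Rightarrow> 'a::real_normed_vector \<Rightarrow>\<^sub>L real). 0 < (\<Sum>k = 1..n. norm (u k) powr p) \<and>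
    (\<forall>y. norm y \<le> 1 \<longrightarrow>
      (\<Sum>k = 1..n. \<bar>blinfun_apply (u k) y\<bar> powr p) \<le> t * (\<Sum>k = 1..n. norm (u k) powr p))"
proof -
  \<comment> \<open>With this constant and the threshold \<open>t / 2\<close> in the
    linear-quadratic bound, the linear and quadratic parts each contribute
    \<open>t / 2 * sum l U\<close>.\<close>
  have "0 < (t / 2)\<^sup>2" using t by simp
  then obtain U :: "('a \<Rightarrow>\<^sub>L real) set" and l where U: "finite U" "U \<subseteq> sphere 0 1"
    and l: "\<And>u. u \<in> U \<Longrightarrow> 0 \<le> l u" "0 < sum l U"
    and small: "\<And>y. norm y \<le> 1 \<Longrightarrow> (\<Sum>u\<in>U. l u * (blinfun_apply u y)\<^sup>2) \<le> (t / 2)\<^sup>2 * sum l U"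
    by (rule dvoretzky_rogers[OF inf]) blast
  obtain h where h: "bij_betw h {1..card U} U"
    using ex_bij_betw_nat_finite_1[OF U(1)] by blast
  have hU: "h k \<in> U" if "k \<in> {1..card U}" for k using h that by (auto simp: bij_betw_def)
  \<comment> \<open>The weights move into the vectors: the exponent \<open>1 / p\<close> makes
    \<open>norm (u k) powr p\<close> equal to the weight.\<close>
  define u where "u k = l (h k) powr (1 / p) *\<^sub>R h k" for k
  have sum_h: "(\<Sum>k = 1..card U. f (h k)) = (\<Sum>v\<in>U. f v)" for f :: "_ \<Rightarrow> real"
    by (rule sum.reindex_bij_betw[OF h])
  have "norm (u k) powr p = l (h k)" if "k \<in> {1..card U}" for k
    using hU[OF that] U(2) l(1) p by (auto simp: u_def powr_powr subset_eq)
  then have mass: "(\<Sum>k = 1..card U. norm (u k) powr p) = sum l U"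
    using sum_h[of l] by simp
  have "(\<Sum>k = 1..card U. \<bar>blinfun_apply (u k) y\<bar> powr p) \<le> t * sum l U" if y: "norm y \<le> 1" for y
  proof -
    have "\<bar>blinfun_apply (u k) y\<bar> powr p = l (h k) * \<bar>blinfun_apply (h k) y\<bar> powr p"
      if "k \<in> {1..card U}" for k
      using l(1)[OF hU[OF that]] p
      by (simp add: u_def blinfun.scaleR_left abs_mult powr_mult powr_powr)
    then have "(\<Sum>k = 1..card U. \<bar>blinfun_apply (u k) y\<bar> powr p)
        = (\<Sum>v\<in>U. l v * \<bar>blinfun_apply v y\<bar> powr p)"
      using sum_h[of "\<lambda>v. l v * \<bar>blinfun_apply v y\<bar> powr p"] by simp
    also have "\<dots> \<le> (\<Sum>v\<in>U. l v * (t / 2 + (blinfun_apply v y)\<^sup>2 / (t / 2)))"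
    proof (intro sum_mono mult_left_mono powr_le_linear_quadratic p l(1))
      fix v assume "v \<in> U"
      then show "\<bar>blinfun_apply v y\<bar> \<le> 1"
        using norm_blinfun[of v y] U(2) y by auto
    qed (use t in auto)
    also have "\<dots> = t / 2 * sum l U + (\<Sum>v\<in>U. l v * (blinfun_apply v y)\<^sup>2) / (t / 2)"
      by (simp add: distrib_left sum.distrib sum_distrib_left sum_divide_distrib mult_ac)
    also have "\<dots> \<le> t / 2 * sum l U + ((t / 2)\<^sup>2 * sum l U) / (t / 2)"
      using t small[OF y] by (intro add_left_mono divide_right_mono) auto
    also have "\<dots> = t * sum l U" using t by (simp add: power2_eq_square field_simps)
    finally show ?thesis .
  qed
  with mass l(2) show ?thesis by (intro exI[of _ "card U"] exI[of _ u]) simp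
qed

text \<open>The restriction of \<open>w\<close> to the annihilator of \<open>F\<close> is not \<open>p\<close>-summing.\<close>

definition nonsumming :: "real \<Rightarrow> (('a::real_normed_vector \<Rightarrow>\<^sub>L real) \<Rightarrow> real) \<Rightarrow> 'a set \<Rightarrow> bool" where
  "nonsumming p w F \<longleftrightarrow> (\<forall>M. \<exists>n (u :: nat \<Rightarrow> 'a \<Rightarrow>\<^sub>L real) D. 0 < D \<and> (\<forall>k. \<forall>v\<in>F. blinfun_apply (u k) v = 0) \<and>
     (\<forall>y. norm y \<le> 1 \<longrightarrow> (\<Sum>k = 1..n. \<bar>blinfun_apply (u k) y\<bar> powr p) \<le> D) \<and>
     M * D \<le> (\<Sum>k = 1..n. w (u k) powr p))"

text \<open>Imposing one more linear condition is a rank-one correction. It changes the weak sums by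
  a bounded factor and the sums of \<open>w\<close> by a multiple of the weak bound. If
  \<open>x\<close> is invisible to the annihilator of \<open>F\<close>, nothing changes.\<close>

lemma nonsumming_annihilator:
  assumes F: "finite F" and p: "1 \<le> p"
    and w_add: "\<And>x y. w (x + y) \<le> w x + w y"
    and w_scale: "\<And>c x. w (c *\<^sub>R x) = \<bar>c\<bar> * w x" and w0: "\<And>x. 0 \<le> w x"
    and empty: "nonsumming p w {}"
  shows "nonsumming p w F"
  using F
proof (induction F rule: finite_induct)
  case (insert x F)
  show ?case
  proof (cases "\<forall>u :: 'a \<Rightarrow>\<^sub>L real. (\<forall>v\<in>F. blinfun_apply u v = 0) \<longrightarrow> blinfun_apply u x = 0")
    case True
    then have "(\<forall>v\<in>insert x F. blinfun_apply u v = 0) \<longleftrightarrow> (\<forall>v\<in>F. blinfun_apply u v = 0)"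
      for u :: "'a \<Rightarrow>\<^sub>L real" by auto
    then show ?thesis using insert.IH by (simp only: nonsumming_def simp_thms)
  next
    case False
    then obtain q :: "'a \<Rightarrow>\<^sub>L real" where q: "\<And>v. v \<in> F \<Longrightarrow> blinfun_apply q v = 0" "blinfun_apply q x \<noteq> 0" by blast
    define r where "r = q /\<^sub>R blinfun_apply q x"
    have r: "blinfun_apply r v = 0" if "v \<in> F" for v
      using q that by (simp add: r_def blinfun.scaleR_left)
    have rx: "blinfun_apply r x = 1" using q by (simp add: r_def blinfun.scaleR_left)
    \<comment> \<open>The factor by which the weak bound grows under the projection along
      \<open>r\<close>.\<close>
    define K where "K = 2 powr p * (1 + norm x powr p * norm r powr p)"
    have K: "0 < K" by (simp add: K_def add_pos_nonneg)
    show ?thesis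
      unfolding nonsumming_def
    proof
      fix M
      \<comment> \<open>The constant asked of the induction hypothesis pays for the factor
        \<open>K\<close>, for the rank-one term and for the factor \<open>2 powr p\<close> lost when
        splitting powers.\<close>
      from insert.IH[unfolded nonsumming_def,
        THEN spec[of _ "2 powr p * (M * K + norm x powr p * w r powr p)"]]
      obtain n D and u :: "nat \<Rightarrow> 'a \<Rightarrow>\<^sub>L real"
        where D: "0 < D" and uF: "\<forall>k. \<forall>v\<in>F. blinfun_apply (u k) v = 0"
        and weak: "\<And>y. norm y \<le> 1 \<Longrightarrow> (\<Sum>k = 1..n. \<bar>blinfun_apply (u k) y\<bar> powr p) \<le> D"
        and strong: "2 powr p * (M * K + norm x powr p * w r powr p) * D \<le> (\<Sum>k = 1..n. w (u k) powr p)"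
        by blast
      \<comment> \<open>Since \<open>r x = 1\<close> and \<open>r\<close> annihilates
        \<open>F\<close>, this kills the value at \<open>x\<close> and keeps the zeros on
        \<open>F\<close>.\<close>
      define u' where "u' k = u k - blinfun_apply (u k) x *\<^sub>R r" for k
      have u': "blinfun_apply (u' k) y = blinfun_apply (u k) y - blinfun_apply (u k) x * blinfun_apply r y"
        for k y by (simp add: u'_def blinfun.diff_left blinfun.scaleR_left)
      have weak_x: "(\<Sum>k = 1..n. \<bar>blinfun_apply (u k) x\<bar> powr p) \<le> norm x powr p * D"
      proof (cases "x = 0")
        case False
        have "\<bar>blinfun_apply (u k) x\<bar> powr p
            = norm x powr p * \<bar>blinfun_apply (u k) (x /\<^sub>R norm x)\<bar> powr p" for k
          using False by (simp add: blinfun.scaleR_right abs_mult mult.assoc[symmetric] flip: powr_mult)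
        then show ?thesis
          using weak[of "x /\<^sub>R norm x"] False by (simp add: mult_left_mono flip: sum_distrib_left)
      qed simp
      have "(\<Sum>k = 1..n. \<bar>blinfun_apply (u' k) y\<bar> powr p) \<le> K * D" if y: "norm y \<le> 1" for y
      proof -
        have ry: "\<bar>blinfun_apply r y\<bar> \<le> norm r"
          using norm_blinfun[of r y] mult_left_mono[OF y, of "norm r"] by simp
        have "(\<Sum>k = 1..n. \<bar>blinfun_apply (u' k) y\<bar> powr p) \<le>
          (\<Sum>k = 1..n. 2 powr p * (\<bar>blinfun_apply (u k) y\<bar> powr p + (\<bar>blinfun_apply (u k) x\<bar> * norm r) powr p))"
        proof (rule sum_mono)
          fix k
          have "\<bar>blinfun_apply (u' k) y\<bar> \<le> \<bar>blinfun_apply (u k) y\<bar> + \<bar>blinfun_apply (u k) x\<bar> * \<bar>blinfun_apply r y\<bar>"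
            unfolding u' abs_mult[symmetric] by (rule abs_triangle_ineq4)
          also have "\<dots> \<le> \<bar>blinfun_apply (u k) y\<bar> + \<bar>blinfun_apply (u k) x\<bar> * norm r"
            using ry by (simp add: mult_left_mono)
          finally show "\<bar>blinfun_apply (u' k) y\<bar> powr p \<le>
            2 powr p * (\<bar>blinfun_apply (u k) y\<bar> powr p + (\<bar>blinfun_apply (u k) x\<bar> * norm r) powr p)"
            using p by (intro order_trans[OF powr_mono2 powr_add_bound]) auto
        qed
        also have "\<dots> = 2 powr p * ((\<Sum>k = 1..n. \<bar>blinfun_apply (u k) y\<bar> powr p)
            + (\<Sum>k = 1..n. \<bar>blinfun_apply (u k) x\<bar> powr p) * norm r powr p)"
          by (simp only: sum_distrib_left[symmetric] sum.distrib powr_mult sum_distrib_right)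
        also have "\<dots> \<le> 2 powr p * (D + (norm x powr p * D) * norm r powr p)"
          using weak[OF y] weak_x by (intro mult_left_mono add_mono mult_right_mono) auto
        also have "\<dots> = K * D" by (simp add: K_def algebra_simps)
        finally show ?thesis .
      qed
      moreover have "M * (K * D) \<le> (\<Sum>k = 1..n. w (u' k) powr p)"
      proof -
        have "(\<Sum>k = 1..n. w (u k) powr p) \<le>
          (\<Sum>k = 1..n. 2 powr p * (w (u' k) powr p + (\<bar>blinfun_apply (u k) x\<bar> * w r) powr p))"
        proof (rule sum_mono)
          fix k
          have "w (u k) \<le> w (u' k) + \<bar>blinfun_apply (u k) x\<bar> * w r"
            using w_add[of "u' k" "blinfun_apply (u k) x *\<^sub>R r"] by (simp add: u'_def w_scale)
          then show "w (u k) powr p \<le>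
            2 powr p * (w (u' k) powr p + (\<bar>blinfun_apply (u k) x\<bar> * w r) powr p)"
            using p w0 by (intro order_trans[OF powr_mono2 powr_add_bound]) auto
        qed
        also have "\<dots> = 2 powr p * ((\<Sum>k = 1..n. w (u' k) powr p)
            + (\<Sum>k = 1..n. \<bar>blinfun_apply (u k) x\<bar> powr p) * w r powr p)"
          by (simp only: sum_distrib_left[symmetric] sum.distrib powr_mult sum_distrib_right)
        also have "\<dots> \<le> 2 powr p * ((\<Sum>k = 1..n. w (u' k) powr p) + (norm x powr p * D) * w r powr p)"
          using weak_x by (intro mult_left_mono add_mono mult_right_mono) auto
        finally have "2 powr p * ((M * K + norm x powr p * w r powr p) * D)
          \<le> 2 powr p * ((\<Sum>k = 1..n. w (u' k) powr p) + norm x powr p * D * w r powr p)"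
          using strong by (simp only: mult.assoc)
        then have "(M * K + norm x powr p * w r powr p) * D
          \<le> (\<Sum>k = 1..n. w (u' k) powr p) + norm x powr p * D * w r powr p" by simp
        then show ?thesis by (simp add: algebra_simps)
      qed
      moreover have "\<forall>k. \<forall>v\<in>insert x F. blinfun_apply (u' k) v = 0"
        using uF r rx by (auto simp: u')
      ultimately show "\<exists>n (u :: nat \<Rightarrow> 'a \<Rightarrow>\<^sub>L real) D. 0 < D \<and> (\<forall>k. \<forall>v\<in>insert x F. blinfun_apply (u k) v = 0) \<and>
        (\<forall>y. norm y \<le> 1 \<longrightarrow> (\<Sum>k = 1..n. \<bar>blinfun_apply (u k) y\<bar> powr p) \<le> D) \<and>
        M * D \<le> (\<Sum>k = 1..n. w (u k) powr p)"
        using K D by (intro exI[of _ n] exI[of _ u'] exI[of _ "K * D"]) auto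
    qed
  qed
qed (rule empty)

text \<open>If the approximant \<open>h\<close> is nonpositive at \<open>x\<close>, it takes the
  value \<open>w (u k) * h x\<close> at the moved points \<open>z k\<close>, where \<open>b\<close>
  is nonnegative. So the \<open>p\<close>-sum of \<open>b - h\<close> there is at least
  \<open>T * \<bar>h x\<bar> powr p\<close>, while the weak sums of the \<open>z k\<close> are at
  most a fixed multiple of \<open>T\<close>. As \<open>T\<close> cancels, \<open>h x\<close> is of
  order \<open>\<epsilon>\<close>.\<close>

lemma FBL_nonneg:
  fixes w :: "('a::real_normed_vector \<Rightarrow>\<^sub>L real) \<Rightarrow> real"
  assumes p: "1 \<le> p"
    and w_add: "\<And>x y. w (x + y) \<le> w x + w y"
    and w_scale: "\<And>c x. w (c *\<^sub>R x) = \<bar>c\<bar> * w x" and w0: "\<And>x. 0 \<le> w x"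
    and ns: "nonsumming p w {}" and b: "b \<in> FBL p"
    and lower: "\<And>x. - max (\<bar>blinfun_apply x e\<bar> - w x) 0 \<le> b x"
  shows "0 \<le> b x"
proof -
  \<comment> \<open>The first term bounds \<open>\<bar>b x - h x\<bar> / \<epsilon>\<close>, the
    second \<open>\<bar>h x\<bar> / \<epsilon>\<close>.\<close>
  define L where "L = norm x + 2 * (norm x powr p + 1) powr (1 / p)"
  have L: "0 \<le> L" by (simp add: L_def)
  have "- b x \<le> \<epsilon> * L" if \<epsilon>: "0 < \<epsilon>" for \<epsilon>
  proof -
    obtain h where h: "h \<in> FVL" "fbl_norm p (\<lambda>t. b t - h t) < ennreal \<epsilon>"
      using b \<epsilon> unfolding FBL_def by blast
    obtain C where C: "fbl_bound p (\<lambda>t. b t - h t) C" "C < \<epsilon>"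
      using fbl_norm_lessE[OF h(2)] .
    have C0: "0 \<le> C" using C by (simp add: fbl_bound_def)
    have hom: "h (c *\<^sub>R y) = c * h y" if "0 \<le> c" for c y
      using h(1) vector_sublattice_FVL H_wstar_scaleR[OF _ that]
      by (auto simp: vector_sublattice_def)
    have bx: "\<bar>b x - h x\<bar> \<le> \<epsilon> * norm x"
    proof -
      \<comment> \<open>Testing with one functional shows that approximation in the
        \<open>p\<close>-norm controls values at single points.\<close>
      have "weak_p_norm p 1 (\<lambda>_. x) \<le> (norm x powr p) powr (1 / p)"
      proof (rule weak_p_norm_le[OF p])
        fix y :: 'a assume "norm y \<le> 1"
        then have "\<bar>blinfun_apply x y\<bar> \<le> norm x"
          using norm_blinfun[of x y] mult_left_mono[of "norm y" 1 "norm x"] by simp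
        then show "(\<Sum>k = 1..1::nat. \<bar>blinfun_apply x y\<bar> powr p) \<le> norm x powr p"
          using p by (simp add: powr_mono2)
      qed
      then have weak: "weak_p_norm p 1 (\<lambda>_. x) \<le> norm x" using p by (simp add: powr_powr)
      have "\<bar>b x - h x\<bar> \<le> C * weak_p_norm p 1 (\<lambda>_. x)"
        using C(1)[unfolded fbl_bound_def, THEN conjunct2, THEN spec[of _ 1], THEN spec[of _ "\<lambda>_. x"]] p
        by (simp add: powr_powr)
      also have "\<dots> \<le> \<epsilon> * norm x"
        using weak C(2) C0 weak_p_norm_nonneg[OF p] \<epsilon> by (intro mult_mono) auto
      finally show ?thesis .
    qed
    show ?thesis
    proof (cases "h x \<le> 0")
      case False
      then have "- b x \<le> \<epsilon> * norm x" using bx by linarith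
      also have "\<dots> \<le> \<epsilon> * L" using \<epsilon> by (simp add: L_def)
      finally show ?thesis .
    next
      case True
      obtain F where F: "finite F" "\<And>y u. (\<forall>v\<in>F. blinfun_apply u v = 0) \<Longrightarrow> h (y + u) = h y"
        using FVL_finite_support[OF h(1)] by blast
      \<comment> \<open>The length of the move: \<open>w (z k)\<close> is at least
        \<open>(R - w x) * w (u k)\<close>, which is \<open>w (u k) * \<bar>x e\<bar>\<close>, the
        absolute value of \<open>z k\<close> at \<open>e\<close>. There the lower bound for
        \<open>b\<close> is 0.\<close>
      define R where "R = w x + \<bar>blinfun_apply x e\<bar>"
      have R: "0 \<le> R" using w0[of x] by (simp add: R_def)
      \<comment> \<open>Annihilating \<open>e\<close> as well keeps the moves from affecting the
        value at \<open>e\<close>.\<close>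
      have "nonsumming p w (insert e F)"
        using F(1) by (intro nonsumming_annihilator[OF _ p w_add w_scale w0 ns]) auto
      \<comment> \<open>\<open>R powr p\<close> lets \<open>T\<close> absorb the weak sums of the
        moves; the extra 1 keeps \<open>T\<close> positive when \<open>R = 0\<close>.\<close>
      from this[unfolded nonsumming_def, THEN spec[of _ "R powr p + 1"]]
      obtain n D and u :: "nat \<Rightarrow> 'a \<Rightarrow>\<^sub>L real"
        where D: "0 < D" and uF: "\<forall>k. \<forall>v\<in>insert e F. blinfun_apply (u k) v = 0"
        and weak: "\<And>y. norm y \<le> 1 \<Longrightarrow> (\<Sum>k = 1..n. \<bar>blinfun_apply (u k) y\<bar> powr p) \<le> D"
        and strong: "(R powr p + 1) * D \<le> (\<Sum>k = 1..n. w (u k) powr p)"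
        by blast
      define T where "T = (\<Sum>k = 1..n. w (u k) powr p)"
      have "R powr p * D \<le> T" using strong D by (simp add: T_def algebra_simps)
      have "0 < (R powr p + 1) * D" using D by (simp add: add_nonneg_pos)
      then have T: "0 < T" using strong by (simp add: T_def)
      \<comment> \<open>\<open>w (u k)\<close> times the point \<open>x + (R / w (u k)) u k\<close>, avoiding division by \<open>0\<close>\<close>
      define z where "z k = w (u k) *\<^sub>R x + R *\<^sub>R u k" for k
      have pointwise: "w (u k) powr p * \<bar>h x\<bar> powr p \<le> \<bar>b (z k) - h (z k)\<bar> powr p" for k
      proof -
        have "h (z k) = h (w (u k) *\<^sub>R x)"
          unfolding z_def using uF by (intro F(2)) (auto simp: blinfun.scaleR_left)
        then have hz: "h (z k) = w (u k) * h x" using hom[OF w0] by simp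
        have ez: "\<bar>blinfun_apply (z k) e\<bar> = w (u k) * \<bar>blinfun_apply x e\<bar>"
          using uF w0[of "u k"] by (simp add: z_def blinfun.add_left blinfun.scaleR_left abs_mult)
        have "w (R *\<^sub>R u k) \<le> w (z k) + w ((- w (u k)) *\<^sub>R x)"
          using w_add[of "z k" "(- w (u k)) *\<^sub>R x"] by (simp add: z_def)
        then have "R * w (u k) \<le> w (z k) + w (u k) * w x"
          using R w0[of "u k"] unfolding w_scale by simp
        then have "\<bar>blinfun_apply (z k) e\<bar> \<le> w (z k)" unfolding ez R_def by (simp add: algebra_simps)
        then have "0 \<le> b (z k)" using lower[of "z k"] by simp
        moreover have "h (z k) \<le> 0" unfolding hz using w0 True by (rule mult_nonneg_nonpos)
        ultimately have "w (u k) * \<bar>h x\<bar> \<le> \<bar>b (z k) - h (z k)\<bar>"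
          using True w0[of "u k"] by (simp add: hz)
        then have "(w (u k) * \<bar>h x\<bar>) powr p \<le> \<bar>b (z k) - h (z k)\<bar> powr p"
          using p w0[of "u k"] by (intro powr_mono2) auto
        then show ?thesis by (simp add: powr_mult)
      qed
      have weak_z: "weak_p_norm p n z \<le> (2 powr p * (T * norm x powr p + T)) powr (1 / p)"
      proof (rule weak_p_norm_le[OF p])
        fix y :: 'a assume y: "norm y \<le> 1"
        have xy: "\<bar>blinfun_apply x y\<bar> \<le> norm x"
          using y norm_blinfun[of x y] mult_left_mono[of "norm y" 1 "norm x"] by simp
        have "(\<Sum>k = 1..n. \<bar>blinfun_apply (z k) y\<bar> powr p) \<le>
          (\<Sum>k = 1..n. 2 powr p * ((w (u k) * norm x) powr p + (R * \<bar>blinfun_apply (u k) y\<bar>) powr p))"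
        proof (rule sum_mono)
          fix k
          have "\<bar>blinfun_apply (z k) y\<bar> \<le> w (u k) * \<bar>blinfun_apply x y\<bar> + R * \<bar>blinfun_apply (u k) y\<bar>"
            using abs_triangle_ineq[of "w (u k) * blinfun_apply x y" "R * blinfun_apply (u k) y"] R w0[of "u k"]
            by (simp add: z_def blinfun.add_left blinfun.scaleR_left abs_mult)
          also have "\<dots> \<le> w (u k) * norm x + R * \<bar>blinfun_apply (u k) y\<bar>"
            using xy w0[of "u k"] by (simp add: mult_left_mono)
          finally show "\<bar>blinfun_apply (z k) y\<bar> powr p \<le>
            2 powr p * ((w (u k) * norm x) powr p + (R * \<bar>blinfun_apply (u k) y\<bar>) powr p)"
            using p R w0[of "u k"] by (intro order_trans[OF powr_mono2 powr_add_bound]) auto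
        qed
        also have "\<dots> = 2 powr p * (T * norm x powr p + R powr p * (\<Sum>k = 1..n. \<bar>blinfun_apply (u k) y\<bar> powr p))"
          unfolding T_def
          by (simp only: sum_distrib_left[symmetric] sum.distrib powr_mult sum_distrib_right)
        also have "\<dots> \<le> 2 powr p * (T * norm x powr p + R powr p * D)"
          using weak[OF y] by (intro mult_left_mono add_left_mono) auto
        also have "\<dots> \<le> 2 powr p * (T * norm x powr p + T)"
          using \<open>R powr p * D \<le> T\<close> by (intro mult_left_mono add_left_mono) auto
        finally show "(\<Sum>k = 1..n. \<bar>blinfun_apply (z k) y\<bar> powr p) \<le> 2 powr p * (T * norm x powr p + T)" .
      qed
      have "T * \<bar>h x\<bar> powr p = (\<Sum>k = 1..n. w (u k) powr p * \<bar>h x\<bar> powr p)"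
        by (simp add: T_def sum_distrib_right)
      also have "\<dots> \<le> (\<Sum>k = 1..n. \<bar>b (z k) - h (z k)\<bar> powr p)" by (intro sum_mono pointwise)
      also have "\<dots> \<le> (C * weak_p_norm p n z) powr p" by (rule fbl_bound_powr[OF p C(1)])
      also have "\<dots> \<le> (\<epsilon> * (2 powr p * (T * norm x powr p + T)) powr (1 / p)) powr p"
        using C(2) C0 weak_z weak_p_norm_nonneg[OF p, of n z] \<epsilon> p by (intro powr_mono2 mult_mono) auto
      also have "\<dots> = \<epsilon> powr p * (2 powr p * (T * norm x powr p + T))"
        using p T by (simp add: powr_mult powr_powr)
      also have "\<dots> = T * (\<epsilon> powr p * (2 powr p * (norm x powr p + 1)))"
        by (simp add: algebra_simps)
      also have "\<dots> = T * (\<epsilon> * (2 * (norm x powr p + 1) powr (1 / p))) powr p"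
        using p \<epsilon> by (simp add: powr_mult powr_powr)
      finally have "\<bar>h x\<bar> powr p \<le> (\<epsilon> * (2 * (norm x powr p + 1) powr (1 / p))) powr p"
        using T by simp
      then have "\<bar>h x\<bar> \<le> \<epsilon> * (2 * (norm x powr p + 1) powr (1 / p))"
        using p \<epsilon> by (smt (verit) powr_less_mono2 mult_nonneg_nonneg powr_ge_zero abs_ge_zero)
      with bx True show ?thesis by (simp add: L_def algebra_simps)
    qed
  qed
  then have le: "- b x \<le> \<epsilon> * L" if "0 < \<epsilon>" for \<epsilon> using that by blast
  have "- b x \<le> 0 + \<eta>" if "0 < \<eta>" for \<eta>
  proof -
    have "\<eta> / (L + 1) * L \<le> \<eta>" using L that by (simp add: field_simps)
    with le[of "\<eta> / (L + 1)"] L that show ?thesis by (simp add: add_nonneg_pos)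
  qed
  then have "- b x \<le> 0" by (rule field_le_epsilon)
  then show ?thesis by simp
qed

section \<open>Construction of the seminorm \<open>w\<close>\<close>

lemma Max_abs_bounds:
  fixes V :: "'a::real_normed_vector set" and x :: "'a \<Rightarrow>\<^sub>L real"
  assumes V: "finite V" "V \<noteq> {}" "V \<subseteq> cball 0 1"
  shows Max_abs_nonneg: "0 \<le> Max ((\<lambda>v. \<bar>blinfun_apply x v\<bar>) ` V)"
    and Max_abs_le_norm: "Max ((\<lambda>v. \<bar>blinfun_apply x v\<bar>) ` V) \<le> norm x"
    and Max_abs_add: "Max ((\<lambda>v. \<bar>blinfun_apply (x + y) v\<bar>) ` V)
      \<le> Max ((\<lambda>v. \<bar>blinfun_apply x v\<bar>) ` V) + Max ((\<lambda>v. \<bar>blinfun_apply y v\<bar>) ` V)"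
    and Max_abs_scaleR: "Max ((\<lambda>v. \<bar>blinfun_apply (c *\<^sub>R x) v\<bar>) ` V)
      = \<bar>c\<bar> * Max ((\<lambda>v. \<bar>blinfun_apply x v\<bar>) ` V)"
proof -
  have ge: "\<bar>blinfun_apply z v\<bar> \<le> Max ((\<lambda>v. \<bar>blinfun_apply z v\<bar>) ` V)" if "v \<in> V" for v and z :: "'a \<Rightarrow>\<^sub>L real"
    using V that by (intro Max_ge) auto
  have le: "Max ((\<lambda>v. \<bar>blinfun_apply z v\<bar>) ` V) \<le> c" if "\<And>v. v \<in> V \<Longrightarrow> \<bar>blinfun_apply z v\<bar> \<le> c"
    for c and z :: "'a \<Rightarrow>\<^sub>L real"
    using V that by (subst Max_le_iff) auto
  obtain v where "v \<in> V" using V by blast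
  then show "0 \<le> Max ((\<lambda>v. \<bar>blinfun_apply x v\<bar>) ` V)" using ge[of v x] by linarith
  show "Max ((\<lambda>v. \<bar>blinfun_apply x v\<bar>) ` V) \<le> norm x"
  proof (rule le)
    fix v assume "v \<in> V"
    then have "norm v \<le> 1" using V by auto
    then show "\<bar>blinfun_apply x v\<bar> \<le> norm x"
      using norm_blinfun[of x v] mult_left_mono[of "norm v" 1 "norm x"] by simp
  qed
  show "Max ((\<lambda>v. \<bar>blinfun_apply (x + y) v\<bar>) ` V)
      \<le> Max ((\<lambda>v. \<bar>blinfun_apply x v\<bar>) ` V) + Max ((\<lambda>v. \<bar>blinfun_apply y v\<bar>) ` V)"
  proof (rule le)
    fix v assume v: "v \<in> V"
    show "\<bar>blinfun_apply (x + y) v\<bar>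
      \<le> Max ((\<lambda>v. \<bar>blinfun_apply x v\<bar>) ` V) + Max ((\<lambda>v. \<bar>blinfun_apply y v\<bar>) ` V)"
      using ge[OF v, of x] ge[OF v, of y] by (simp add: blinfun.add_left)
  qed
  have "Max ((\<lambda>t. \<bar>c\<bar> * t) ` (\<lambda>v. \<bar>blinfun_apply x v\<bar>) ` V)
      = \<bar>c\<bar> * Max ((\<lambda>v. \<bar>blinfun_apply x v\<bar>) ` V)"
    by (rule mono_Max_commute[symmetric]) (use V in \<open>auto simp: mono_def mult_left_mono\<close>)
  then show "Max ((\<lambda>v. \<bar>blinfun_apply (c *\<^sub>R x) v\<bar>) ` V)
      = \<bar>c\<bar> * Max ((\<lambda>v. \<bar>blinfun_apply x v\<bar>) ` V)"
    by (simp add: image_image blinfun.scaleR_left abs_mult)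
qed

text \<open>A single weighted series defeats all constants at once: its \<open>j\<close>-th summand
  almost norms a family on which it beats the weak sums by the factor \<open>Suc j\<close>. The
  partial sums lie in \<open>FVL\<close>, and \<open>\<epsilon>\<close> is the tail of the
  weights.\<close>

lemma ex_nonsumming_seminorm:
  assumes inf: "\<nexists>B :: 'a::real_normed_vector set. finite B \<and> span B = UNIV"
    and p: "1 \<le> p" and s: "0 < s"
  obtains w :: "('a::real_normed_vector \<Rightarrow>\<^sub>L real) \<Rightarrow> real" and W :: "nat \<Rightarrow> ('a \<Rightarrow>\<^sub>L real) \<Rightarrow> real" and \<epsilon>
  where "\<And>x y. w (x + y) \<le> w x + w y" "\<And>c x. w (c *\<^sub>R x) = \<bar>c\<bar> * w x" "\<And>x. 0 \<le> w x"
    "\<And>x. w x \<le> s * norm x" "nonsumming p w {}"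
    "\<And>m. W m \<in> FVL" "\<And>m x. W m x \<le> w x"
    "\<And>m x. w x - W m x \<le> \<epsilon> m * norm x" "\<epsilon> \<longlonglongrightarrow> 0"
proof -
  \<comment> \<open>Weights with total \<open>s\<close>, so that \<open>w\<close> is at most
    \<open>s\<close> times the norm.\<close>
  define a where "a j = s / 2 * (1 / 2) ^ j" for j :: nat
  have a: "0 < a j" for j using s by (simp add: a_def)
  have a_sums: "a sums s"
    using sums_mult[OF geometric_sums[of "1 / 2 :: real"], of "s / 2"]
    by (simp add: a_def[abs_def])
  \<comment> \<open>In \<open>a j / 2\<close>, the weight is that of the \<open>j\<close>-th summand
    and the half is lost by norming only up to a factor 2; \<open>Suc j\<close> is the growing
    margin.\<close>
  define Q where "Q j n u V \<longleftrightarrow> finite V \<and> V \<noteq> {} \<and> V \<subseteq> cball 0 1 \<and>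
      (\<forall>k\<in>{1..n}. \<exists>v\<in>V. norm (u k) / 2 \<le> \<bar>blinfun_apply (u k) v\<bar>) \<and>
      0 < (\<Sum>k = 1..n. norm (u k) powr p) \<and>
      (\<forall>y. norm y \<le> 1 \<longrightarrow> (\<Sum>k = 1..n. \<bar>blinfun_apply (u k) y\<bar> powr p)
         \<le> (a j / 2) powr p / Suc j * (\<Sum>k = 1..n. norm (u k) powr p))"
    for j n and u :: "nat \<Rightarrow> 'a \<Rightarrow>\<^sub>L real" and V
  have "\<exists>n u V. Q j n u V" for j
  proof -
    have "0 < (a j / 2) powr p / Suc j" using a[of j] by simp
    from dvoretzky_rogers_powr[OF inf p this]
    obtain n and u :: "nat \<Rightarrow> 'a \<Rightarrow>\<^sub>L real" where u: "0 < (\<Sum>k = 1..n. norm (u k) powr p)"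
      "\<forall>y. norm y \<le> 1 \<longrightarrow> (\<Sum>k = 1..n. \<bar>blinfun_apply (u k) y\<bar> powr p)
         \<le> (a j / 2) powr p / Suc j * (\<Sum>k = 1..n. norm (u k) powr p)" by blast
    have "\<exists>v. norm v \<le> 1 \<and> norm (u k) / 2 \<le> \<bar>blinfun_apply (u k) v\<bar>" for k
      using ex_almost_norming[of "u k"] by blast
    then obtain v where v: "\<And>k. norm (v k) \<le> 1" "\<And>k. norm (u k) / 2 \<le> \<bar>blinfun_apply (u k) (v k)\<bar>"
      by metis
    \<comment> \<open>Adding 0 makes the set visibly nonempty and does not affect the other
      conditions.\<close>
    have "Q j n u (insert 0 (v ` {1..n}))"
      unfolding Q_def using u v by auto
    then show ?thesis by blast
  qed
  then obtain n u V where Q: "\<And>j. Q j (n j) (u j) (V j)" by metis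
  then have V: "finite (V j)" "V j \<noteq> {}" "V j \<subseteq> cball 0 1" for j by (auto simp: Q_def)
  define M where "M j x = Max ((\<lambda>v. \<bar>blinfun_apply x v\<bar>) ` V j)"
    for j and x :: "'a \<Rightarrow>\<^sub>L real"
  have M0: "0 \<le> M j x" and M_le: "M j x \<le> norm x" and M_add: "M j (x + y) \<le> M j x + M j y"
    and M_scale: "M j (c *\<^sub>R x) = \<bar>c\<bar> * M j x" for j x y c
    unfolding M_def by (rule Max_abs_bounds[OF V])+
  have summ: "summable (\<lambda>j. a j * M j x)" for x
  proof (rule summable_comparison_test')
    show "summable (\<lambda>j. a j * norm x)" by (intro summable_mult2 sums_summable[OF a_sums])
    show "norm (a j * M j x) \<le> a j * norm x" if "0 \<le> j" for j
      using M0[of j x] M_le[of j x] a[of j] by (simp add: abs_mult)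
  qed
  define w where "w x = (\<Sum>j. a j * M j x)" for x
  define W where "W m x = (\<Sum>j<m. a j * M j x)" for m x
  define \<epsilon> where "\<epsilon> m = s - (\<Sum>j<m. a j)" for m
  have w_ge: "a j * M j x \<le> w x" for j x
    unfolding w_def using sum_le_suminf[OF summ, of "{j}" x] a M0 by (simp add: less_imp_le)
  show ?thesis
  proof (rule that[of w W \<epsilon>])
    show "w (x + y) \<le> w x + w y" for x y
      unfolding w_def suminf_add[OF summ summ]
      using a M_add by (intro suminf_le summ summable_add) (auto simp flip: distrib_left simp: mult_left_mono less_imp_le)
    show "w (c *\<^sub>R x) = \<bar>c\<bar> * w x" for c x
      unfolding w_def M_scale using suminf_mult[OF summ, of "\<bar>c\<bar>" x] by (simp add: mult_ac)
    show w0: "0 \<le> w x" for x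
      unfolding w_def using a M0 by (intro suminf_nonneg summ) (simp add: less_imp_le)
    show "w x \<le> s * norm x" for x
    proof -
      have "w x \<le> (\<Sum>j. a j * norm x)"
        unfolding w_def using a M_le
        by (intro suminf_le summ summable_mult2 sums_summable[OF a_sums]) (simp add: less_imp_le)
      also have "\<dots> = s * norm x"
        using sums_unique[OF sums_mult2[OF a_sums, of "norm x"]] by simp
      finally show ?thesis .
    qed
    show "W m x \<le> w x" for m x
      unfolding w_def W_def using a M0 by (intro sum_le_suminf summ) (simp_all add: less_imp_le)
    show "w x - W m x \<le> \<epsilon> m * norm x" for m x
    proof -
      have "w x - W m x = (\<Sum>j. a (j + m) * M (j + m) x)"
        unfolding w_def W_def by (subst suminf_minus_initial_segment[OF summ]) simp
      also have "\<dots> \<le> (\<Sum>j. a (j + m) * norm x)"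
        using a M_le summ[of x] sums_summable[OF a_sums]
        by (intro suminf_le summable_mult2) (simp_all add: less_imp_le summable_iff_shift[of "\<lambda>j. a j * M j x" m] summable_iff_shift[of a m])
      also have "\<dots> = (\<Sum>j. a (j + m)) * norm x"
        using sums_summable[OF a_sums] by (intro suminf_mult2[symmetric]) (simp add: summable_iff_shift)
      also have "(\<Sum>j. a (j + m)) = \<epsilon> m"
        unfolding \<epsilon>_def using suminf_minus_initial_segment[OF sums_summable[OF a_sums], of m]
          sums_unique[OF a_sums] by simp
      finally show ?thesis .
    qed
    show "\<epsilon> \<longlonglongrightarrow> 0"
      unfolding \<epsilon>_def using a_sums[unfolded sums_def] by (auto intro!: tendsto_eq_intros)
    show "W m \<in> FVL" for m
    proof (induction m)
      case 0
      then show ?case using zero_in_FVL by (simp add: W_def[abs_def])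
    next
      case (Suc m)
      have "(\<lambda>x. a m * M m x) \<in> FVL"
        unfolding M_def by (intro FVL_scale FVL_Max_abs V)
      with Suc have "(\<lambda>x. W m x + a m * M m x) \<in> FVL" by (rule FVL_add)
      then show ?case by (simp add: W_def[abs_def])
    qed
    show "nonsumming p w {}"
      unfolding nonsumming_def
    proof
      fix K :: real
      obtain j :: nat where j: "K \<le> real j" using real_arch_simple by blast
      define T where "T = (\<Sum>k = 1..n j. norm (u j k) powr p)"
      define D where "D = (a j / 2) powr p / Suc j * T"
      have T: "0 < T" using Q[of j] by (simp add: Q_def T_def)
      then have D: "0 < D" using a[of j] by (simp add: D_def)
      have "K * D \<le> Suc j * D" using j D by (intro mult_right_mono) auto
      also have "\<dots> = (a j / 2) powr p * T" by (simp add: D_def)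
      also have "\<dots> = (\<Sum>k = 1..n j. (a j / 2 * norm (u j k)) powr p)"
        by (simp only: T_def powr_mult sum_distrib_left)
      also have "\<dots> \<le> (\<Sum>k = 1..n j. w (u j k) powr p)"
      proof (rule sum_mono)
        fix k assume "k \<in> {1..n j}"
        then obtain v where v: "v \<in> V j" "norm (u j k) / 2 \<le> \<bar>blinfun_apply (u j k) v\<bar>"
          using Q[of j] unfolding Q_def by blast
        have "\<bar>blinfun_apply (u j k) v\<bar> \<le> M j (u j k)"
          unfolding M_def using V v by (intro Max_ge) auto
        with v have "a j * (norm (u j k) / 2) \<le> a j * M j (u j k)"
          using a[of j] by (intro mult_left_mono) auto
        also have "\<dots> \<le> w (u j k)" by (rule w_ge)
        finally show "(a j / 2 * norm (u j k)) powr p \<le> w (u j k) powr p"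
          using p a[of j] by (intro powr_mono2) auto
      qed
      finally have "K * D \<le> (\<Sum>k = 1..n j. w (u j k) powr p)" .
      moreover have "\<forall>y. norm y \<le> 1 \<longrightarrow> (\<Sum>k = 1..n j. \<bar>blinfun_apply (u j k) y\<bar> powr p) \<le> D"
        using Q[of j] unfolding Q_def D_def T_def by blast
      ultimately show "\<exists>n (u :: nat \<Rightarrow> 'a \<Rightarrow>\<^sub>L real) D. 0 < D \<and> (\<forall>k. \<forall>v\<in>{}. blinfun_apply (u k) v = 0) \<and>
        (\<forall>y. norm y \<le> 1 \<longrightarrow> (\<Sum>k = 1..n. \<bar>blinfun_apply (u k) y\<bar> powr p) \<le> D) \<and>
        K * D \<le> (\<Sum>k = 1..n. w (u k) powr p)"
        using D by (intro exI[of _ "n j"] exI[of _ "u j"] exI[of _ D]) simp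
    qed
  qed
qed

lemma order_ideal_hull_closed:
  assumes "g \<in> order_ideal H hull S" "f \<in> H" "\<And>t. \<bar>f t\<bar> \<le> \<bar>g t\<bar>"
  shows "f \<in> order_ideal H hull S"
  using assms unfolding hull_def order_ideal_def by blast

subsection \<open>Failure of regularity\<close>

theorem theorem10p1:
  fixes i :: "'a::banach \<Rightarrow>\<^sub>L 'b::banach" and p :: real
  assumes "\<not> (\<exists>B :: 'a set. finite B \<and> span B = UNIV)"
    and "\<not> (\<exists>B :: 'b set. finite B \<and> span B = UNIV)"
    and "\<forall>x. norm (blinfun_apply i x) = norm x"
    and "1 \<le> p"
  shows "\<not> regular_image (induced_hom i) (FBL p) (I_wstar p)"
proof
  assume regular: "regular_image (induced_hom i) (FBL p) (I_wstar p)"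
  note p = assms(4)
  have "UNIV \<noteq> {0 :: 'a}" using assms(1) by (metis finite.emptyI span_empty)
  then obtain e :: 'a where "e \<noteq> 0" by blast
  \<comment> \<open>The functional \<open>y0\<close> on the larger space is chosen first, so that
    \<open>x0\<close> is a pullback and the failure at \<open>x0\<close> can be seen over
    \<open>'b\<close>.\<close>
  then have "blinfun_apply i e \<noteq> 0" using assms(3) by (metis norm_eq_zero)
  then obtain y0 :: "'b \<Rightarrow>\<^sub>L real" where y0: "blinfun_apply y0 (blinfun_apply i e) \<noteq> 0"
    by (rule ex_functional_neq_zero)
  define x0 where "x0 = y0 o\<^sub>L i"
  have x0: "0 < \<bar>blinfun_apply x0 e\<bar>" using y0 by (simp add: x0_def)
  \<comment> \<open>Scaled so that \<open>w x0 < \<bar>x0 e\<bar>\<close>, that is,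
    \<open>g x0 > 0\<close>; the summand 1 gives strictness and a nonzero denominator.\<close>
  define s where "s = \<bar>blinfun_apply x0 e\<bar> / (norm x0 + 1)"
  have "0 < s" using x0 by (simp add: s_def add_nonneg_pos)
  then obtain w :: "('a \<Rightarrow>\<^sub>L real) \<Rightarrow> real" and W and \<epsilon>
    where w: "\<And>x y. w (x + y) \<le> w x + w y" "\<And>c x. w (c *\<^sub>R x) = \<bar>c\<bar> * w x" "\<And>x. 0 \<le> w x"
      "\<And>x. w x \<le> s * norm x" "nonsumming p w {}"
    and W: "\<And>m. W m \<in> FVL" "\<And>m x. W m x \<le> w x"
      "\<And>m x. w x - W m x \<le> \<epsilon> m * norm x" and \<epsilon>: "\<epsilon> \<longlonglongrightarrow> 0"
    using ex_nonsumming_seminorm[OF assms(1) p] by blast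
  have wx0: "w x0 < \<bar>blinfun_apply x0 e\<bar>"
  proof -
    have "s * norm x0 < s * (norm x0 + 1)" using \<open>0 < s\<close> by simp
    also have "\<dots> = \<bar>blinfun_apply x0 e\<bar>" by (simp add: s_def add_nonneg_pos[THEN less_imp_neq, symmetric])
    finally show ?thesis using w(4)[of x0] by linarith
  qed
  define g where "g x = max (\<bar>blinfun_apply x e\<bar> - w x) 0" for x
  define q where "q m x = max (\<bar>blinfun_apply x e\<bar> - W m x) 0" for m x
  have g_le_q: "g x \<le> q m x" for m x using W(2)[of m x] by (auto simp: g_def q_def)
  have close: "\<bar>q m x - g x\<bar> \<le> \<epsilon> m * norm x" for m x
    using W(2)[of m x] W(3)[of x m] by (auto simp: g_def q_def max_def)
  have q_FVL: "q m \<in> FVL" for m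
  proof -
    have "(\<lambda>x. max (\<bar>delta e x\<bar> + (- 1) * W m x) 0) \<in> FVL"
      by (intro FVL_max FVL_add FVL_abs FVL_scale delta_in_FVL W zero_in_FVL)
    then show ?thesis by (simp add: q_def[abs_def] delta_def)
  qed
  have q_H: "q m \<in> H_wstar" for m
    using q_FVL vector_sublattice_FVL by (auto simp: vector_sublattice_def)
  have g_H: "g \<in> H_wstar"
  proof (rule H_wstar_uniform_limit[OF _ q_H close \<epsilon>])
    fix c :: real and x assume "0 \<le> c"
    then show "g (c *\<^sub>R x) = c * g x"
      by (simp add: g_def w(2) blinfun.scaleR_left abs_mult max_mult_distrib_left right_diff_distrib)
  qed
  \<comment> \<open>Regularity concerns suprema, so the decreasing sequence \<open>q\<close> enters
    with a minus sign.\<close>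
  define A where "A = (\<lambda>m x. - q m x) ` UNIV"
  have A_FBL: "A \<subseteq> FBL p"
    using FVL_subset_FBL[OF p] FVL_scale[OF q_FVL, of "- 1"] by (auto simp: A_def)
  have "is_supremum_in (FBL p) A (\<lambda>_. 0)"
    unfolding is_supremum_in_def
  proof (intro conjI ballI impI)
    show "(\<lambda>_. 0) \<in> FBL p" using zero_in_FVL FVL_subset_FBL[OF p] by blast
    show "a \<le> (\<lambda>_. 0)" if "a \<in> A" for a using that by (auto simp: A_def q_def le_fun_def)
    fix b assume b: "b \<in> FBL p" and ub: "\<forall>a\<in>A. a \<le> b"
    \<comment> \<open>An upper bound of all \<open>- q m\<close> dominates their pointwise limit, to
      which the positivity lemma applies.\<close>
    have lower: "- g x \<le> b x" for x
    proof -
      have "(\<lambda>m. q m x - g x) \<longlonglongrightarrow> 0"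
        by (rule Lim_null_comparison[where g = "\<lambda>m. \<epsilon> m * norm x"])
          (use close \<epsilon> in \<open>auto intro!: tendsto_eq_intros\<close>)
      then have "(\<lambda>m. - q m x) \<longlonglongrightarrow> - g x" by (intro tendsto_minus) (simp add: LIM_zero_cancel)
      moreover have "- q m x \<le> b x" for m using ub by (auto simp: A_def le_fun_def)
      ultimately show ?thesis by (intro LIMSEQ_le_const2) auto
    qed
    have "0 \<le> b x" for x
      by (rule FBL_nonneg[OF p w(1,2,3,5) b lower[unfolded g_def]])
    then show "(\<lambda>_. 0) \<le> b" by (simp add: le_fun_def)
  qed
  with regular A_FBL have sup: "is_supremum_in (I_wstar p) (induced_hom i ` A) (induced_hom i (\<lambda>_. 0))"
    unfolding regular_image_def by blast
  \<comment> \<open>A competitor that is negative at \<open>y0\<close>. It lies in the ideal because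
    \<open>g\<close> is at most \<open>\<bar>\<delta>\<^sub>e\<bar>\<close>, whose pullback is the
    modulus of the evaluation at \<open>i e\<close>.\<close>
  define b where "b = induced_hom i (\<lambda>x. - g x)"
  have b_H: "b \<in> H_wstar" unfolding b_def using H_wstar_scale[OF g_H, of "- 1"] by (intro induced_hom_H_wstar) simp
  have delta: "delta (blinfun_apply i e) \<in> I_wstar p"
    unfolding I_wstar_def using FVL_subset_FBL[OF p] delta_in_FVL by (intro hull_inc) blast
  have "\<bar>b y\<bar> \<le> \<bar>delta (blinfun_apply i e) y\<bar>" for y
    using w(3)[of "y o\<^sub>L i"] by (simp add: b_def induced_hom_def g_def delta_def)
  with delta b_H have "b \<in> I_wstar p" unfolding I_wstar_def by (rule order_ideal_hull_closed)
  moreover have "\<forall>a\<in>induced_hom i ` A. a \<le> b"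
    using g_le_q by (auto simp: A_def b_def induced_hom_def le_fun_def)
  ultimately have "induced_hom i (\<lambda>_. 0) \<le> b" using sup unfolding is_supremum_in_def by blast
  then have "g x0 \<le> 0" by (auto simp: b_def induced_hom_def le_fun_def x0_def)
  with wx0 show False by (simp add: g_def)
qed

end
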